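(* Let $M$ be a finitely generated commutative monoid and let $M\curvearrowright X$ be a free bounded-to-one Borel action on a standard Borel space $X$. Then $\operatorname{asdim}_B(M\curvearrowright X)<\infty$. Equivalently, for some, hence every, finite generating set $R$ of $M$, the Schreier graph $G_R^X$ has finite Borel asymptotic dimension.
   Context: An action $M\curvearrowright X$ is free if for all $x\in X$ and $m,n\in M$, $mx=nx$ implies $m=n$. It is bounded-to-one if for every $m\in M$ there is $k_m\in\mathbb N$ such that all fibers of $x\mapsto mx$ have at most $k_m$ elements. It is Borel if each map $x\mapsto mx$ is Borel. For $R\subseteq M$, the Schreier graph $G_R^X$ is the graph on $X$ in which distinct points $x,y$ are adjacent iff $y=rx$ or $x=ry$ for some $r\in R$. For a graph $G$ on $X$, $\rho_G$ is the path metric (infinite between different components) and $B_G(x,s)$ is the ball of radius $s$ about $x$. Let $G$ be a locally finite Borel graph on a standard Borel space $X$ and $s,d\in\mathbb N$. A Borel uncolored dimension $d$ witness at scale $s$ for $G$ is a Borel function $f:X\to X$ such that $\sup_x\rho_G(x,f(x))<\infty$ and $|f[B_G(x,s)]|\le d+1$ for all $x\in X$. We write $\operatorname{asdim}_B(G)\le d$ if for every $s\in\mathbb N$ such a witness exists; $\operatorname{asdim}_B(G)$ is the least such $d$ ($\infty$ if there is none). For $M$ finitely generated, $\operatorname{asdim}_B(M\curvearrowright X):=\operatorname{asdim}_B(G_R^X)$ for any finite generating set $R$ of $M$; this does not depend on $R$. *)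

theory Defs
  imports "HOL-Analysis.Analysis" "HOL-Algebra.Group"
begin

text \<open>Spaces are given as measure-type objects, of which only the underlying set \<open>space X\<close> and
  the \<open>\<sigma>\<close>-algebra \<open>sets X\<close> are used; the measure itself plays no role.
  A topology is Polish if it is completely metrizable and second countable.\<close>

definition standard_borel :: "'x measure \<Rightarrow> bool" where
  "standard_borel X \<longleftrightarrow>
     (\<exists>T. topspace T = space X \<and> completely_metrizable_space T \<and> second_countable T \<and>
          sets X = sigma_sets (space X) {U. openin T U})"

definition generates :: "('m, 'b) monoid_scheme \<Rightarrow> 'm set \<Rightarrow> bool" where
  "generates M R \<longleftrightarrow>
     R \<subseteq> carrier M \<and> (\<forall>H. submonoid H M \<longrightarrow> R \<subseteq> H \<longrightarrow> H = carrier M)"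

definition finitely_generated :: "('m, 'b) monoid_scheme \<Rightarrow> bool" where
  "finitely_generated M \<longleftrightarrow> (\<exists>R. finite R \<and> generates M R)"

definition monoid_action ::
    "('m, 'b) monoid_scheme \<Rightarrow> 'x set \<Rightarrow> ('m \<Rightarrow> 'x \<Rightarrow> 'x) \<Rightarrow> bool" where
  "monoid_action M S act \<longleftrightarrow>
     (\<forall>m\<in>carrier M. \<forall>x\<in>S. act m x \<in> S) \<and>
     (\<forall>x\<in>S. act \<one>\<^bsub>M\<^esub> x = x) \<and>
     (\<forall>m\<in>carrier M. \<forall>n\<in>carrier M. \<forall>x\<in>S. act (m \<otimes>\<^bsub>M\<^esub> n) x = act m (act n x))"

definition free_action ::
    "('m, 'b) monoid_scheme \<Rightarrow> 'x set \<Rightarrow> ('m \<Rightarrow> 'x \<Rightarrow> 'x) \<Rightarrow> bool" where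
  "free_action M S act \<longleftrightarrow>
     (\<forall>x\<in>S. \<forall>m\<in>carrier M. \<forall>n\<in>carrier M. act m x = act n x \<longrightarrow> m = n)"

definition bounded_to_one_action ::
    "('m, 'b) monoid_scheme \<Rightarrow> 'x set \<Rightarrow> ('m \<Rightarrow> 'x \<Rightarrow> 'x) \<Rightarrow> bool" where
  "bounded_to_one_action M S act \<longleftrightarrow>
     (\<forall>m\<in>carrier M. \<exists>k::nat. \<forall>y\<in>S.
        finite {x\<in>S. act m x = y} \<and> card {x\<in>S. act m x = y} \<le> k)"

definition borel_action ::
    "('m, 'b) monoid_scheme \<Rightarrow> 'x measure \<Rightarrow> ('m \<Rightarrow> 'x \<Rightarrow> 'x) \<Rightarrow> bool" where
  "borel_action M X act \<longleftrightarrow> (\<forall>m\<in>carrier M. act m \<in> X \<rightarrow>\<^sub>M X)"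

text \<open>A graph is given by a vertex set and an adjacency relation supported on it.\<close>

definition schreier_adj :: "'x set \<Rightarrow> ('m \<Rightarrow> 'x \<Rightarrow> 'x) \<Rightarrow> 'm set \<Rightarrow> 'x \<Rightarrow> 'x \<Rightarrow> bool" where
  "schreier_adj S act R x y \<longleftrightarrow>
     x \<in> S \<and> y \<in> S \<and> x \<noteq> y \<and> (\<exists>r\<in>R. y = act r x \<or> x = act r y)"

text \<open>The infimum of the empty set is \<open>\<infinity>\<close> in \<^typ>\<open>enat\<close>, so points in different components have
  infinite distance.\<close>

definition path_dist :: "('x \<Rightarrow> 'x \<Rightarrow> bool) \<Rightarrow> 'x \<Rightarrow> 'x \<Rightarrow> enat" where
  "path_dist E x y = Inf {enat n | n. (E ^^ n) x y}"

definition graph_ball :: "'x set \<Rightarrow> ('x \<Rightarrow> 'x \<Rightarrow> bool) \<Rightarrow> 'x \<Rightarrow> nat \<Rightarrow> 'x set" where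
  "graph_ball S E x s = {y\<in>S. path_dist E x y \<le> enat s}"

text \<open>The notions below are meant for locally finite Borel graphs, such as the Schreier graphs
  with respect to finite sets of bounded-to-one Borel actions.\<close>

definition uncolored_dim_witness ::
    "'x measure \<Rightarrow> ('x \<Rightarrow> 'x \<Rightarrow> bool) \<Rightarrow> nat \<Rightarrow> nat \<Rightarrow> ('x \<Rightarrow> 'x) \<Rightarrow> bool" where
  "uncolored_dim_witness X E d s f \<longleftrightarrow>
     f \<in> X \<rightarrow>\<^sub>M X \<and>
     (SUP x\<in>space X. path_dist E x (f x)) < \<infinity> \<and>
     (\<forall>x\<in>space X. finite (f ` graph_ball (space X) E x s) \<and>
                   card (f ` graph_ball (space X) E x s) \<le> d + 1)"

definition borel_asdim_le :: "'x measure \<Rightarrow> ('x \<Rightarrow> 'x \<Rightarrow> bool) \<Rightarrow> nat \<Rightarrow> bool" where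
  "borel_asdim_le X E d \<longleftrightarrow> (\<forall>s. \<exists>f. uncolored_dim_witness X E d s f)"

definition borel_asdim :: "'x measure \<Rightarrow> ('x \<Rightarrow> 'x \<Rightarrow> bool) \<Rightarrow> enat" where
  "borel_asdim X E = Inf {enat d | d. borel_asdim_le X E d}"

text \<open>For finitely generated \<open>M\<close> and a bounded-to-one Borel action the value does not depend on
  the chosen finite generating set.\<close>

definition borel_asdim_action ::
    "('m, 'b) monoid_scheme \<Rightarrow> 'x measure \<Rightarrow> ('m \<Rightarrow> 'x \<Rightarrow> 'x) \<Rightarrow> enat" where
  "borel_asdim_action M X act =
     borel_asdim X (schreier_adj (space X) act (SOME R. finite R \<and> generates M R))"

end

theory Submission
  imports Defs "HOL-Algebra.FiniteProduct"
begin

text \<open>Multiplication by a high power of the product of the generators pushes an undirected ball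
  about \<open>x\<close> into a forward ball of the orbit \<open>M x\<close>, so it suffices to retract forward balls onto few
  points. For this one wants a Borel set of markers which every point reaches by a forward move of
  bounded length and whose members in a common forward orbit have disjoint forward cubes \<open>cube s\<close>.
  Freeness then turns disjointness into a volume bound, and polynomial growth of \<open>M\<close> keeps the
  number of markers near a point below a constant for arbitrarily large scales \<open>s\<close>.

  The markers are chosen greedily along a finite Borel colouring, each decision being shifted
  forward so that it depends on forward orbits only. The finite colouring is the one place where
  points in backward direction matter: the colours occurring there are over-approximated by means of
  Novikov's form of Lusin's separation theorem, and bounded fibres keep the approximations small.\<close>

section \<open>Clopen parametrizations of Borel sets\<close>

text \<open>Asking whether a point has a backward neighbour in a Borel set asks for an image of a
  Borel set. Hence a conflict between two markers y and y' is recorded by two equations, m y = c y'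
  and m' y' = c y with one fixed c: whichever marker is treated later sees a translate of the other
  in its own forward orbit. Commutativity supplies c, a power of the product of the generators. The
  factor 5 in the growth estimate: a ball of radius s is pushed into \<open>cube (2 * s)\<close>
  applied to x, reaching a marker costs another \<open>cube (2 * s)\<close>, and the cube of side s
  at each marker brings the total to \<open>cube (5 * s)\<close>. As \<open>cube n\<close> has at
  most (n + 1)^|R| elements, the ratio of the sizes at 5s and s cannot exceed 5^(|R| + 1) at all
  large s; this number bounds the dimension.\<close>

definition agree :: "nat \<Rightarrow> (nat \<Rightarrow> nat) \<Rightarrow> (nat \<Rightarrow> nat) \<Rightarrow> bool" where
  "agree n a b \<longleftrightarrow> (\<forall>i<n. a i = b i)"

definition seq_closed :: "(nat \<Rightarrow> nat) set \<Rightarrow> bool" where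
  "seq_closed F \<longleftrightarrow> (\<forall>a. (\<forall>n. \<exists>b\<in>F. agree n a b) \<longrightarrow> a \<in> F)"

text \<open>\<open>B\<close> need not lie in the space, so the same notion applied to
  \<open>- B\<close>, a complement in the whole type, expresses that the preimage is closed in
  \<open>F\<close>.\<close>

definition open_preimage :: "(nat \<Rightarrow> nat) set \<Rightarrow> ((nat \<Rightarrow> nat) \<Rightarrow> 'a) \<Rightarrow> 'a set \<Rightarrow> bool" where
  "open_preimage F g B \<longleftrightarrow> (\<forall>a\<in>F. g a \<in> B \<longrightarrow> (\<exists>n. \<forall>b\<in>F. agree n a b \<longrightarrow> g b \<in> B))"

text \<open>A continuous surjection from a closed subset of Baire space. Keeping \<open>T\<close>
  fixed and changing only the parametrization replaces the usual refinement of a Polish topology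
  that turns Borel sets into clopen ones.\<close>

definition parametrizes :: "'a topology \<Rightarrow> (nat \<Rightarrow> nat) set \<Rightarrow> ((nat \<Rightarrow> nat) \<Rightarrow> 'a) \<Rightarrow> bool" where
  "parametrizes T F g \<longleftrightarrow>
     seq_closed F \<and> g ` F = topspace T \<and> (\<forall>U. openin T U \<longrightarrow> open_preimage F g U)"

lemma parametrizes_image: "parametrizes T F g \<Longrightarrow> g ` F = topspace T"
  by (simp add: parametrizes_def)

lemma agree_mono: "agree n a b \<Longrightarrow> m \<le> n \<Longrightarrow> agree m a b"
  by (simp add: agree_def)

lemma seq_closedI:
  assumes "\<And>a. (\<And>n. \<exists>b\<in>F. agree n a b) \<Longrightarrow> a \<in> F"
  shows "seq_closed F"
  using assms by (auto simp: seq_closed_def)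

lemma seq_closedD: "seq_closed F \<Longrightarrow> (\<And>n. \<exists>b\<in>F. agree n a b) \<Longrightarrow> a \<in> F"
  by (auto simp: seq_closed_def)

lemma open_preimageD:
  assumes "open_preimage F g B" "a \<in> F" "g a \<in> B"
  obtains n where "\<And>b. b \<in> F \<Longrightarrow> agree n a b \<Longrightarrow> g b \<in> B"
  using assms unfolding open_preimage_def by blast

lemma open_preimage_cong:
  assumes "open_preimage F g A" "g ` F \<subseteq> S" "A \<inter> S = B \<inter> S"
  shows "open_preimage F g B"
  unfolding open_preimage_def
proof (intro ballI impI)
  fix a assume a: "a \<in> F" "g a \<in> B"
  then have "g a \<in> A" using assms(2,3) by blast
  then obtain n where "\<And>b. b \<in> F \<Longrightarrow> agree n a b \<Longrightarrow> g b \<in> A"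
    using open_preimageD[OF assms(1) a(1)] by blast
  then show "\<exists>n. \<forall>b\<in>F. agree n a b \<longrightarrow> g b \<in> B"
    using assms(2,3) by blast
qed

lemma open_preimage_UN:
  assumes "\<And>i. i \<in> I \<Longrightarrow> open_preimage F g (B i)"
  shows "open_preimage F g (\<Union>i\<in>I. B i)"
  unfolding open_preimage_def
proof (intro ballI impI)
  fix a assume a: "a \<in> F" "g a \<in> (\<Union>i\<in>I. B i)"
  then obtain i where i: "i \<in> I" "g a \<in> B i" by blast
  then obtain n where "\<And>b. b \<in> F \<Longrightarrow> agree n a b \<Longrightarrow> g b \<in> B i"
    using open_preimageD[OF assms[OF i(1)] a(1)] by blast
  then show "\<exists>n. \<forall>b\<in>F. agree n a b \<longrightarrow> g b \<in> (\<Union>i\<in>I. B i)"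
    using i(1) by blast
qed

lemma seq_closed_preimage:
  assumes F: "seq_closed F" and B: "open_preimage F g (- B)"
  shows "seq_closed {a \<in> F. g a \<in> B}"
proof (rule seq_closedI)
  fix a assume *: "\<And>n. \<exists>b\<in>{a \<in> F. g a \<in> B}. agree n a b"
  have a: "a \<in> F"
    by (rule seq_closedD[OF F]) (use * in blast)
  have "g a \<in> B"
  proof (rule ccontr)
    assume "g a \<notin> B"
    then obtain n where "\<And>b. b \<in> F \<Longrightarrow> agree n a b \<Longrightarrow> g b \<in> - B"
      using open_preimageD[OF B a] by blast
    then show False using *[of n] by blast
  qed
  with a show "a \<in> {a \<in> F. g a \<in> B}" by simp
qed

lemma agree_Suc_comp: "agree (Suc n) a b \<Longrightarrow> agree n (a \<circ> Suc) (b \<circ> Suc) \<and> a 0 = b 0"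
  by (simp add: agree_def)

text \<open>Prefixing a sequence with the index of a piece of a cover by sets with closed preimages
  makes every union of pieces clopen.\<close>

lemma parametrizes_split:
  assumes P: "parametrizes T F g" and cover: "topspace T \<subseteq> (\<Union>n::nat. E n)"
    and E: "\<And>n. open_preimage F g (- E n)"
  obtains F' g' where "parametrizes T F' g'"
    "\<And>B. open_preimage F g B \<Longrightarrow> open_preimage F' g' B"
    "\<And>B. (\<And>n. E n \<subseteq> B \<or> E n \<inter> B = {}) \<Longrightarrow> open_preimage F' g' B"
proof
  define F' where "F' = {a. a \<circ> Suc \<in> F \<and> g (a \<circ> Suc) \<in> E (a 0)}"
  define g' where "g' = (\<lambda>a. g (a \<circ> Suc))"
  show pre: "open_preimage F' g' B" if B: "open_preimage F g B" for B
    unfolding open_preimage_def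
  proof (intro ballI impI)
    fix a assume a: "a \<in> F'" "g' a \<in> B"
    then obtain n where n: "\<And>b. b \<in> F \<Longrightarrow> agree n (a \<circ> Suc) b \<Longrightarrow> g b \<in> B"
      using open_preimageD[OF B, of "a \<circ> Suc"] by (auto simp: F'_def g'_def)
    have "g' b \<in> B" if "b \<in> F'" "agree (Suc n) a b" for b
      using n[of "b \<circ> Suc"] agree_Suc_comp[OF that(2)] that(1) by (simp add: F'_def g'_def)
    then show "\<exists>n. \<forall>b\<in>F'. agree n a b \<longrightarrow> g' b \<in> B" by blast
  qed
  show "open_preimage F' g' B" if B: "\<And>n. E n \<subseteq> B \<or> E n \<inter> B = {}" for B
    unfolding open_preimage_def
  proof (intro ballI impI)
    fix a assume a: "a \<in> F'" "g' a \<in> B"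
    then have *: "E (a 0) \<subseteq> B"
      using B[of "a 0"] by (auto simp: F'_def g'_def)
    have "g' b \<in> B" if "b \<in> F'" "agree 1 a b" for b
      using * that by (auto simp: F'_def g'_def agree_def)
    then show "\<exists>n. \<forall>b\<in>F'. agree n a b \<longrightarrow> g' b \<in> B" by blast
  qed
  have "seq_closed F'"
  proof (rule seq_closedI)
    fix a assume *: "\<And>n. \<exists>b\<in>F'. agree n a b"
    have "a \<circ> Suc \<in> {b \<in> F. g b \<in> E (a 0)}"
    proof (rule seq_closedD[OF seq_closed_preimage])
      show "seq_closed F" using P by (simp add: parametrizes_def)
      show "open_preimage F g (- E (a 0))" by (rule E)
      show "\<exists>b\<in>{b \<in> F. g b \<in> E (a 0)}. agree n (a \<circ> Suc) b" for n
      proof -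
        obtain b where "b \<in> F'" "agree (Suc n) a b" using * by blast
        then show ?thesis
          using agree_Suc_comp[of n a b] by (auto simp: F'_def)
      qed
    qed
    then show "a \<in> F'" by (simp add: F'_def)
  qed
  moreover have "g' ` F' = topspace T"
  proof
    show "g' ` F' \<subseteq> topspace T"
      using parametrizes_image[OF P] by (auto simp: F'_def g'_def)
    show "topspace T \<subseteq> g' ` F'"
    proof
      fix x assume x: "x \<in> topspace T"
      then obtain a where a: "a \<in> F" "g a = x"
        using parametrizes_image[OF P] by force
      obtain n where "x \<in> E n" using cover x by blast
      moreover have "case_nat n a \<circ> Suc = a" by auto
      ultimately have "case_nat n a \<in> F'" "g' (case_nat n a) = x"
        using a by (simp_all add: F'_def g'_def)
      then show "x \<in> g' ` F'" by blast
    qed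
  qed
  ultimately show "parametrizes T F' g'"
    using P pre by (simp add: parametrizes_def)
qed

text \<open>One coordinate of the homeomorphism between Baire space and its countable power.\<close>

definition seq_row :: "nat \<Rightarrow> (nat \<Rightarrow> nat) \<Rightarrow> nat \<Rightarrow> nat" where
  "seq_row j a = (\<lambda>i. a (prod_encode (j, i)))"

lemma agree_seq_row: "\<exists>m. \<forall>a b. agree m a b \<longrightarrow> agree n (seq_row j a) (seq_row j b)"
proof -
  define m where "m = Suc (Max ((\<lambda>i. prod_encode (j, i)) ` {..n}))"
  have "prod_encode (j, i) < m" if "i < n" for i
    using that unfolding m_def by (intro le_imp_less_Suc Max_ge) auto
  then have "\<forall>a b. agree m a b \<longrightarrow> agree n (seq_row j a) (seq_row j b)"
    by (auto simp: agree_def seq_row_def)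
  then show ?thesis by blast
qed

text \<open>The fibre product over \<open>T\<close>: sequences whose rows all name the same point.
  It is closed because \<open>T\<close> is Hausdorff, and continuity of each row lets it inherit
  whatever is open for one of the given parametrizations.\<close>

lemma parametrizes_fibre:
  fixes Fs :: "nat \<Rightarrow> (nat \<Rightarrow> nat) set"
  assumes T: "Hausdorff_space T" and P: "\<And>j. parametrizes T (Fs j) (gs j)"
  obtains F g where "parametrizes T F g"
    "\<And>j B. open_preimage (Fs j) (gs j) B \<Longrightarrow> open_preimage F g B"
proof
  define F where "F = {a. \<forall>j. seq_row j a \<in> Fs j \<and> gs j (seq_row j a) = gs 0 (seq_row 0 a)}"
  define g where "g = (\<lambda>a. gs 0 (seq_row 0 a))"
  have gj: "g a = gs j (seq_row j a)" if "a \<in> F" for a j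
  proof -
    have "gs j (seq_row j a) = gs 0 (seq_row 0 a)" using that by (simp add: F_def)
    then show ?thesis by (simp add: g_def)
  qed
  show pre: "open_preimage F g B" if B: "open_preimage (Fs j) (gs j) B" for j B
    unfolding open_preimage_def
  proof (intro ballI impI)
    fix a assume a: "a \<in> F" "g a \<in> B"
    obtain n where n: "\<And>b. b \<in> Fs j \<Longrightarrow> agree n (seq_row j a) b \<Longrightarrow> gs j b \<in> B"
      using open_preimageD[OF B, of "seq_row j a"] a gj[OF a(1), of j] by (auto simp: F_def)
    obtain m where m: "\<And>a b. agree m a b \<Longrightarrow> agree n (seq_row j a) (seq_row j b)"
      using agree_seq_row by meson
    have "g b \<in> B" if "b \<in> F" "agree m a b" for b
      using n[of "seq_row j b"] m[OF that(2)] that(1) gj[OF that(1), of j] by (auto simp: F_def)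
    then show "\<exists>n. \<forall>b\<in>F. agree n a b \<longrightarrow> g b \<in> B" by blast
  qed
  have "seq_closed F"
  proof (rule seq_closedI)
    fix a assume *: "\<And>n. \<exists>b\<in>F. agree n a b"
    have rows: "seq_row j a \<in> Fs j" for j
    proof (rule seq_closedD)
      show "seq_closed (Fs j)" using P by (simp add: parametrizes_def)
      fix n
      obtain m where "\<And>a b. agree m a b \<Longrightarrow> agree n (seq_row j a) (seq_row j b)"
        using agree_seq_row by meson
      then show "\<exists>b\<in>Fs j. agree n (seq_row j a) b"
        using *[of m] by (auto simp: F_def)
    qed
    \<comment> \<open>Distinct points would have disjoint neighbourhoods, each forced by finitely
      many coordinates; an element of \<open>F\<close> agreeing with \<open>a\<close> that far would
      name a point in both.\<close>
    have "gs j (seq_row j a) = gs 0 (seq_row 0 a)" for j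
    proof (rule ccontr)
      assume ne: "gs j (seq_row j a) \<noteq> gs 0 (seq_row 0 a)"
      have top: "gs i (seq_row i a) \<in> topspace T" for i
        using P[of i] rows[of i] by (auto simp: parametrizes_def)
      obtain U V where UV: "openin T U" "openin T V" "gs j (seq_row j a) \<in> U" "gs 0 (seq_row 0 a) \<in> V"
        "disjnt U V"
        using T ne top unfolding Hausdorff_space_def by metis
      obtain n where n: "\<And>b. b \<in> Fs j \<Longrightarrow> agree n (seq_row j a) b \<Longrightarrow> gs j b \<in> U"
        using open_preimageD[of "Fs j" "gs j" U "seq_row j a"] P[of j] UV rows
        by (auto simp: parametrizes_def)
      obtain n' where n': "\<And>b. b \<in> Fs 0 \<Longrightarrow> agree n' (seq_row 0 a) b \<Longrightarrow> gs 0 b \<in> V"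
        using open_preimageD[of "Fs 0" "gs 0" V "seq_row 0 a"] P[of 0] UV rows
        by (auto simp: parametrizes_def)
      obtain m where m: "\<And>a b. agree m a b \<Longrightarrow> agree n (seq_row j a) (seq_row j b)"
        using agree_seq_row by meson
      obtain m' where m': "\<And>a b. agree m' a b \<Longrightarrow> agree n' (seq_row 0 a) (seq_row 0 b)"
        using agree_seq_row by meson
      obtain b where b: "b \<in> F" "agree (max m m') a b" using * by blast
      then have "gs j (seq_row j b) \<in> U"
        using n[of "seq_row j b"] m[OF agree_mono[OF b(2)]] by (auto simp: F_def)
      moreover have "gs 0 (seq_row 0 b) \<in> V"
        using n'[of "seq_row 0 b"] m'[OF agree_mono[OF b(2)]] b(1) by (auto simp: F_def)
      ultimately show False
        using UV(5) gj[OF b(1), of j] gj[OF b(1), of 0] by (metis disjnt_iff)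
    qed
    with rows show "a \<in> F" by (simp add: F_def)
  qed
  moreover have "g ` F = topspace T"
  proof
    show "g ` F \<subseteq> topspace T"
      using P[of 0] by (auto simp: parametrizes_def F_def g_def)
    show "topspace T \<subseteq> g ` F"
    proof
      fix x assume "x \<in> topspace T"
      then have "\<exists>a\<in>Fs j. gs j a = x" for j
        using parametrizes_image[OF P, of j] by (metis imageE)
      then obtain as where as: "\<And>j. as j \<in> Fs j" "\<And>j. gs j (as j) = x"
        by metis
      define a where "a = (\<lambda>k. case prod_decode k of (j, i) \<Rightarrow> as j i)"
      have seq_row: "seq_row j a = as j" for j
        by (simp add: seq_row_def a_def)
      then have "a \<in> F" "g a = x"
        using as by (simp_all add: F_def g_def)
      then show "x \<in> g ` F" by blast
    qed
  qed
  ultimately show "parametrizes T F g"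
    using P[of 0] pre[of 0] by (simp add: parametrizes_def)
qed

text \<open>A sequence names the limit of the dense points \<open>x (a n)\<close>. The Cauchy rate
  is built into \<open>F\<close>, so the coordinate \<open>a n\<close> alone locates the limit
  within (1/2)^n; this gives continuity.\<close>

lemma Polish_parametrizes:
  assumes "completely_metrizable_space T" "second_countable T"
  obtains F g where "parametrizes T F g"
proof (cases "topspace T = {}")
  case True
  then have "parametrizes T {} (\<lambda>a. undefined)"
    by (auto simp: parametrizes_def seq_closed_def open_preimage_def)
  then show ?thesis using that by blast
next
  case False
  obtain M d where Md: "Metric_space M d" "Metric_space.mcomplete M d"
    and T: "T = Metric_space.mtopology M d"
    using assms(1) unfolding completely_metrizable_space_def by blast
  interpret Metric_space M d by (rule Md(1))
  have M: "topspace T = M" by (simp add: T)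
  obtain C where C: "countable C" "C \<subseteq> M" "T closure_of C = M"
    using second_countable_imp_separable_space[OF assms(2)]
    unfolding separable_space_def M by blast
  have "C \<noteq> {}" using C(3) False M by auto
  then obtain x :: "nat \<Rightarrow> 'a" where x: "range x = C"
    using C(1) by (metis range_from_nat_into)
  have xM [simp]: "x i \<in> M" for i using x C(2) by blast
  have dense: "\<exists>i. d (x i) y \<le> e" if "y \<in> M" "e > 0" for y e
  proof -
    have "y \<in> T closure_of C" using that C(3) by simp
    then have "\<exists>z\<in>C. z \<in> mball y e"
      using that unfolding T metric_closure_of by blast
    then show ?thesis
      using x by (metis commute in_mball less_eq_real_def rangeE)
  qed
  \<comment> \<open>Each clause involves two coordinates only, so \<open>F\<close> is closed; any
    choice of dense points within (1/2)^n of a given point satisfies all clauses by the triangle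
    inequality.\<close>
  define F where "F = {a. \<forall>n m. d (x (a n)) (x (a m)) \<le> (1/2)^n + (1/2)^m}"
  have ex: "\<exists>y\<in>M. \<forall>n. d (x (a n)) y \<le> (1/2)^n" if a: "a \<in> F" for a
  proof -
    have "MCauchy (\<lambda>n. x (a n))"
      unfolding MCauchy_def
    proof (intro conjI allI impI)
      fix e :: real assume "e > 0"
      then obtain N where N: "(1/2)^N < e/2"
        using real_arch_pow_inv[of "e/2" "1/2"] by auto
      have "d (x (a n)) (x (a m)) < e" if "N \<le> n" "N \<le> m" for n m
      proof -
        have "(1/2)^n \<le> (1/2::real)^N" "(1/2)^m \<le> (1/2::real)^N"
          using that by (simp_all add: power_decreasing)
        moreover have "d (x (a n)) (x (a m)) \<le> (1/2)^n + (1/2)^m"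
          using a by (simp add: F_def)
        ultimately show ?thesis using N by linarith
      qed
      then show "\<exists>N. \<forall>n n'. N \<le> n \<longrightarrow> N \<le> n' \<longrightarrow> d (x (a n)) (x (a n')) < e" by blast
    qed auto
    then obtain y where y: "limitin mtopology (\<lambda>n. x (a n)) y sequentially"
      using Md(2) unfolding mcomplete_def by blast
    then have yM: "y \<in> M" by (simp add: limitin_mspace)
    have "d (x (a n)) y \<le> (1/2)^n" for n
    proof (rule field_le_epsilon)
      fix e :: real assume "e > 0"
      obtain N1 where N1: "(1/2)^N1 < e/2"
        using real_arch_pow_inv[of "e/2" "1/2"] \<open>e > 0\<close> by auto
      obtain N2 where N2: "\<And>m. m \<ge> N2 \<Longrightarrow> d (x (a m)) y < e/2"
        using y \<open>e > 0\<close> unfolding limit_metric_sequentially by (meson half_gt_zero)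
      define m where "m = max N1 N2"
      have "d (x (a n)) y \<le> d (x (a n)) (x (a m)) + d (x (a m)) y"
        using yM by (simp add: triangle)
      moreover have "d (x (a n)) (x (a m)) \<le> (1/2)^n + (1/2)^m"
        using a by (simp add: F_def)
      moreover have "(1/2)^m \<le> (1/2::real)^N1"
        by (simp add: m_def power_decreasing)
      moreover have "d (x (a m)) y < e/2" using N2 by (simp add: m_def)
      ultimately show "d (x (a n)) y \<le> (1/2)^n + e" using N1 by linarith
    qed
    with yM show ?thesis by blast
  qed
  then obtain g where g: "\<And>a. a \<in> F \<Longrightarrow> g a \<in> M"
    "\<And>a n. a \<in> F \<Longrightarrow> d (x (a n)) (g a) \<le> (1/2)^n"
    by metis
  have "seq_closed F"
  proof (rule seq_closedI)
    fix a assume *: "\<And>n. \<exists>b\<in>F. agree n a b"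
    have "d (x (a n)) (x (a m)) \<le> (1/2)^n + (1/2)^m" for n m
    proof -
      obtain b where "b \<in> F" "agree (Suc (max n m)) a b" using * by blast
      moreover from this have "a n = b n" "a m = b m" by (simp_all add: agree_def)
      ultimately show ?thesis by (simp add: F_def)
    qed
    then show "a \<in> F" by (simp add: F_def)
  qed
  moreover have "g ` F = M"
  proof
    show "g ` F \<subseteq> M" using g(1) by blast
    show "M \<subseteq> g ` F"
    proof
      fix y assume y: "y \<in> M"
      have "\<exists>i. d (x i) y \<le> (1/2)^n" for n
        by (rule dense[OF y]) simp
      then obtain a where a: "\<And>n. d (x (a n)) y \<le> (1/2)^n" by metis
      have "d (x (a n)) (x (a m)) \<le> (1/2)^n + (1/2)^m" for n m
        using triangle[of "x (a n)" y "x (a m)"] a[of n] a[of m] y by (simp add: commute)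
      then have aF: "a \<in> F" by (simp add: F_def)
      have "d (g a) y \<le> 0"
      proof (rule field_le_epsilon)
        fix e :: real assume "e > 0"
        then obtain n where n: "(1/2)^n < e/2"
          using real_arch_pow_inv[of "e/2" "1/2"] by auto
        have "d (g a) y \<le> d (g a) (x (a n)) + d (x (a n)) y"
          using y g(1)[OF aF] by (simp add: triangle)
        then show "d (g a) y \<le> 0 + e"
          using n a[of n] g(2)[OF aF, of n] by (simp add: commute)
      qed
      then have "g a = y"
        using y g(1)[OF aF] by (meson mdist_pos_eq nonneg antisym zero)
      then show "y \<in> g ` F" using aF by blast
    qed
  qed
  moreover have "open_preimage F g U" if U: "openin T U" for U
    unfolding open_preimage_def
  proof (intro ballI impI)
    fix a assume a: "a \<in> F" "g a \<in> U"
    obtain r where r: "r > 0" "mball (g a) r \<subseteq> U"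
      using U a(2) unfolding T openin_mtopology by blast
    obtain n where n: "(1/2)^n < r/2"
      using real_arch_pow_inv[of "r/2" "1/2"] r(1) by auto
    have "g b \<in> U" if b: "b \<in> F" "agree (Suc n) a b" for b
    proof -
      have "a n = b n" using b(2) by (simp add: agree_def)
      then have "d (x (a n)) (g b) \<le> (1/2)^n"
        using g(2)[OF b(1), of n] by simp
      moreover have "d (g a) (x (a n)) \<le> (1/2)^n"
        using g(2)[OF a(1), of n] by (simp add: commute)
      moreover have "d (g a) (g b) \<le> d (g a) (x (a n)) + d (x (a n)) (g b)"
        using g(1)[OF a(1)] g(1)[OF b(1)] by (simp add: triangle)
      ultimately have "d (g a) (g b) \<le> (1/2)^n + (1/2)^n" by linarith
      then have "d (g a) (g b) < r" using n by linarith
      then show ?thesis using r(2) g(1)[OF a(1)] g(1)[OF b(1)] by (auto simp: in_mball)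
    qed
    then show "\<exists>n. \<forall>b\<in>F. agree n a b \<longrightarrow> g b \<in> U" by blast
  qed
  ultimately have "parametrizes T F g"
    unfolding parametrizes_def M by blast
  then show ?thesis using that by blast
qed

text \<open>Open sets are F-sigma and become clopen after one splitting; the claim is symmetric
  under complements. For a union, a fibre product merges the parametrizations of the members, which
  makes the union open, and a splitting into the members and the remainder makes it clopen.\<close>

lemma Borel_clopen_parametrization:
  assumes T: "completely_metrizable_space T" "second_countable T"
    and B: "B \<in> sigma_sets (topspace T) {U. openin T U}"
  shows "\<exists>F g. parametrizes T F g \<and> open_preimage F g B \<and> open_preimage F g (- B)"
  using B
proof (induction rule: sigma_sets.induct)
  case (Basic U)
  have met: "metrizable_space T"
    by (rule completely_metrizable_imp_metrizable_space[OF T(1)])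
  obtain F g where P: "parametrizes T F g"
    using Polish_parametrizes[OF T] .
  have "fsigma_in T U"
    using Basic met by (simp add: open_imp_fsigma_in)
  then obtain C where C: "\<And>n::nat. closedin T (C n)" "\<Union> (range C) = U"
    unfolding fsigma_in_ascending by blast
  \<comment> \<open>Piece 0 is the complement of \<open>U\<close>, the others are closed sets
    exhausting \<open>U\<close>; so each piece lies inside \<open>U\<close> or misses it.\<close>
  define E where "E = case_nat (topspace T - U) C"
  have "closedin T (E n)" for n
    using C(1) Basic by (cases n) (auto simp: E_def)
  then have "open_preimage F g (topspace T - E n)" for n
    using P by (simp add: parametrizes_def openin_diff)
  then have En: "open_preimage F g (- E n)" for n
    by (rule open_preimage_cong[where S = "topspace T"])
      (use parametrizes_image[OF P] in auto)
  have "(\<Union>n. E n) = (topspace T - U) \<union> \<Union> (range C)"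
    by (auto simp: E_def split: nat.splits)
  then have cover: "topspace T \<subseteq> (\<Union>n. E n)" using C(2) by auto
  obtain F' g' where F': "parametrizes T F' g'"
    "\<And>B. (\<And>n. E n \<subseteq> B \<or> E n \<inter> B = {}) \<Longrightarrow> open_preimage F' g' B"
    using parametrizes_split[OF P cover En] by metis
  have sub: "E n \<subseteq> U \<or> E n \<inter> U = {}" for n
    using C(2) by (cases n) (auto simp: E_def)
  then have "open_preimage F' g' U" by (rule F'(2))
  moreover have "open_preimage F' g' (- U)"
    by (rule F'(2)) (use sub in blast)
  ultimately show ?case using F'(1) by blast
next
  case Empty
  obtain F g where P: "parametrizes T F g"
    using Polish_parametrizes[OF T] .
  then show ?case by (auto simp: open_preimage_def)
next
  case (Compl B)
  then obtain F g where P: "parametrizes T F g"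
    and F: "open_preimage F g B" "open_preimage F g (- B)" by blast
  have "open_preimage F g (topspace T - B)"
    by (rule open_preimage_cong[OF F(2), where S = "topspace T"])
      (use parametrizes_image[OF P] in auto)
  moreover have "open_preimage F g (- (topspace T - B))"
    by (rule open_preimage_cong[OF F(1), where S = "topspace T"])
      (use parametrizes_image[OF P] in auto)
  ultimately show ?case using P by blast
next
  case (Union B)
  then obtain Fs gs where "\<And>i. parametrizes T (Fs i) (gs i)"
    and Fs: "\<And>i. open_preimage (Fs i) (gs i) (B i)" "\<And>i. open_preimage (Fs i) (gs i) (- B i)"
    by metis
  moreover have "Hausdorff_space T"
    using T(1) by (simp add: completely_metrizable_imp_metrizable_space metrizable_imp_Hausdorff_space)
  ultimately obtain F g where P: "parametrizes T F g"
    and Fg: "\<And>j B. open_preimage (Fs j) (gs j) B \<Longrightarrow> open_preimage F g B"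
    using parametrizes_fibre by metis
  define E where "E = case_nat (topspace T - (\<Union>i. B i)) B"
  have En: "open_preimage F g (- E n)" for n
  proof (cases n)
    case 0
    have "open_preimage F g (\<Union>i. B i)"
      by (rule open_preimage_UN) (use Fg Fs in blast)
    then show ?thesis
      by (rule open_preimage_cong[where S = "topspace T"])
        (use parametrizes_image[OF P] in \<open>auto simp: E_def 0\<close>)
  next
    case (Suc m)
    then show ?thesis using Fg[OF Fs(2)[of m]] by (simp add: E_def)
  qed
  have "x \<in> (\<Union>n. E n)" if x: "x \<in> topspace T" for x
  proof (cases "x \<in> (\<Union>i. B i)")
    case True
    then obtain i where "x \<in> E (Suc i)" by (auto simp: E_def)
    then show ?thesis by blast
  next
    case False
    then have "x \<in> E 0" using x by (simp add: E_def)
    then show ?thesis by blast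
  qed
  then have cover: "topspace T \<subseteq> (\<Union>n. E n)" by blast
  obtain F' g' where F': "parametrizes T F' g'"
    "\<And>B. (\<And>n. E n \<subseteq> B \<or> E n \<inter> B = {}) \<Longrightarrow> open_preimage F' g' B"
    using parametrizes_split[OF P cover En] by metis
  have sub: "E n \<subseteq> (\<Union>i. B i) \<or> E n \<inter> (\<Union>i. B i) = {}" for n
    by (cases n) (auto simp: E_def)
  then have "open_preimage F' g' (\<Union>i. B i)" by (rule F'(2))
  moreover have "open_preimage F' g' (- (\<Union>i. B i))"
    by (rule F'(2)) (use sub in blast)
  ultimately show ?case using F'(1) by blast
qed

lemma countable_Borel_clopen_parametrization:
  assumes T: "completely_metrizable_space T" "second_countable T"
    and W: "countable W" "W \<subseteq> sigma_sets (topspace T) {U. openin T U}"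
  obtains F g where "parametrizes T F g"
    "\<And>B. B \<in> W \<Longrightarrow> open_preimage F g B" "\<And>B. B \<in> W \<Longrightarrow> open_preimage F g (- B)"
proof -
  define B where "B = from_nat_into (insert {} W)"
  have ran: "range B = insert {} W"
    using W(1) by (simp add: B_def)
  have "B i \<in> sigma_sets (topspace T) {U. openin T U}" for i
  proof -
    have "B i \<in> insert {} W" using ran by blast
    then show ?thesis using W(2) by (auto intro: sigma_sets.Empty)
  qed
  then have "\<exists>F g. parametrizes T F g \<and> open_preimage F g (B i) \<and> open_preimage F g (- B i)" for i
    by (rule Borel_clopen_parametrization[OF T])
  then obtain Fs gs where "\<And>i. parametrizes T (Fs i) (gs i)"
    and Fs: "\<And>i. open_preimage (Fs i) (gs i) (B i)" "\<And>i. open_preimage (Fs i) (gs i) (- B i)"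
    by metis
  moreover have "Hausdorff_space T"
    using T(1) by (simp add: completely_metrizable_imp_metrizable_space metrizable_imp_Hausdorff_space)
  ultimately obtain F g where P: "parametrizes T F g"
    and Fg: "\<And>j B. open_preimage (Fs j) (gs j) B \<Longrightarrow> open_preimage F g B"
    using parametrizes_fibre by metis
  have "open_preimage F g (B i)" "open_preimage F g (- B i)" for i
    using Fg Fs by blast+
  with ran have "open_preimage F g A \<and> open_preimage F g (- A)" if "A \<in> W" for A
    using that by (metis insertCI rangeE)
  with P that show ?thesis by blast
qed

section \<open>Separation of images by Borel sets\<close>

text \<open>For two sets this says that they have disjoint Borel supersets.\<close>

definition Borel_separable :: "'x measure \<Rightarrow> 'i set \<Rightarrow> ('i \<Rightarrow> 'x set) \<Rightarrow> bool" where
  "Borel_separable X J S \<longleftrightarrow>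
     (\<exists>C. (\<forall>a\<in>J. C a \<in> sets X \<and> S a \<subseteq> C a) \<and> (\<Inter>a\<in>J. C a) = {})"

text \<open>Applied in contrapositive form: inseparable unions have an inseparable choice of pieces.
  The superset for \<open>a\<close> collects, for each k, the common part of the separators of all
  choices p with \<open>p a = k\<close>; a point in all these supersets would determine a choice
  whose separators all contain it.\<close>

lemma Borel_separable_split:
  assumes J: "finite J" "J \<noteq> {}"
    and V: "\<And>p. p \<in> J \<rightarrow>\<^sub>E (UNIV :: nat set) \<Longrightarrow> Borel_separable X J (\<lambda>a. V a (p a))"
  shows "Borel_separable X J (\<lambda>a. \<Union>k. V a k)"
proof -
  define P where "P = (J \<rightarrow>\<^sub>E (UNIV :: nat set))"
  have "countable P"
    unfolding P_def by (rule countable_PiE[OF J(1)]) simp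
  have "\<exists>C. \<forall>p\<in>P. (\<forall>a\<in>J. C p a \<in> sets X \<and> V a (p a) \<subseteq> C p a) \<and> (\<Inter>a\<in>J. C p a) = {}"
    using V unfolding Borel_separable_def P_def by (intro bchoice) blast
  then obtain C where C: "\<And>p a. p \<in> P \<Longrightarrow> a \<in> J \<Longrightarrow> C p a \<in> sets X"
    "\<And>p a. p \<in> P \<Longrightarrow> a \<in> J \<Longrightarrow> V a (p a) \<subseteq> C p a"
    "\<And>p. p \<in> P \<Longrightarrow> (\<Inter>a\<in>J. C p a) = {}"
    by blast
  define C' where "C' = (\<lambda>a. \<Union>k. \<Inter>p\<in>{p\<in>P. p a = k}. C p a)"
  have "C' a \<in> sets X" if a: "a \<in> J" for a
  proof -
    have "(\<Inter>p\<in>{p\<in>P. p a = k}. C p a) \<in> sets X" for k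
    proof (rule sets.countable_INT')
      show "countable {p \<in> P. p a = k}"
        using \<open>countable P\<close> by (rule countable_subset[rotated]) blast
      have "(\<lambda>b\<in>J. k) \<in> {p\<in>P. p a = k}" using a by (simp add: P_def)
      then show "{p \<in> P. p a = k} \<noteq> {}" by blast
    qed (use C(1) a in blast)
    then show ?thesis unfolding C'_def by (intro sets.countable_UN) blast
  qed
  moreover have "(\<Union>k. V a k) \<subseteq> C' a" if a: "a \<in> J" for a
    using C(2)[OF _ a] unfolding C'_def by blast
  moreover have "(\<Inter>a\<in>J. C' a) = {}"
  proof (rule ccontr)
    assume "(\<Inter>a\<in>J. C' a) \<noteq> {}"
    then obtain x where "\<forall>a\<in>J. x \<in> C' a" by blast
    then have "\<forall>a\<in>J. \<exists>k. x \<in> (\<Inter>p\<in>{p\<in>P. p a = k}. C p a)"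
      by (simp add: C'_def)
    then obtain q where q: "\<And>a. a \<in> J \<Longrightarrow> x \<in> (\<Inter>p\<in>{p\<in>P. p a = q a}. C p a)"
      using bchoice[of J "\<lambda>a k. x \<in> (\<Inter>p\<in>{p\<in>P. p a = k}. C p a)"] by blast
    define p where "p = restrict q J"
    have "p \<in> P" by (simp add: p_def P_def)
    moreover have "x \<in> C p a" if "a \<in> J" for a
      using q[OF that] \<open>p \<in> P\<close> that by (auto simp: p_def)
    ultimately show False using C(3) by blast
  qed
  ultimately show ?thesis unfolding Borel_separable_def by blast
qed

text \<open>Lusin's separation theorem, in Novikov's form for finitely many sets. If the images were not separable, splitting the
  parameter space repeatedly would produce one parameter for each index at which all pieces stay
  inseparable; but two of the limit points differ and have disjoint neighbourhoods.\<close>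

theorem Borel_images_separable:
  fixes X :: "'x measure" and D :: "'i \<Rightarrow> 'x set"
  assumes X: "standard_borel X" and f: "f \<in> X \<rightarrow>\<^sub>M X"
    and J: "finite J" "J \<noteq> {}" and D: "\<And>a. a \<in> J \<Longrightarrow> D a \<in> sets X"
    and disj: "(\<Inter>a\<in>J. f ` D a) = {}"
  shows "Borel_separable X J (\<lambda>a. f ` D a)"
proof (rule ccontr)
  assume nsep: "\<not> ?thesis"
  obtain T where T: "topspace T = space X" "completely_metrizable_space T" "second_countable T"
    and sets: "sets X = sigma_sets (topspace T) {U. openin T U}"
    using X unfolding standard_borel_def by metis
  have Haus: "Hausdorff_space T"
    using T(2) by (simp add: completely_metrizable_imp_metrizable_space metrizable_imp_Hausdorff_space)
  obtain \<B> where \<B>: "countable \<B>" "\<And>V. V \<in> \<B> \<Longrightarrow> openin T V"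
    "\<And>U x. openin T U \<Longrightarrow> x \<in> U \<Longrightarrow> \<exists>V\<in>\<B>. x \<in> V \<and> V \<subseteq> U"
    using T(3) unfolding second_countable_def by metis
  have open_sets: "U \<in> sets X" if "openin T U" for U
    using that unfolding sets by blast
  \<comment> \<open>Clopenness of these sets makes f after g continuous and the parameters of each
    \<open>D a\<close> a closed set.\<close>
  define W where "W = (\<lambda>V. f -` V \<inter> space X) ` \<B> \<union> D ` J"
  have "countable W" using \<B>(1) J(1) by (simp add: W_def countable_finite)
  moreover have "W \<subseteq> sigma_sets (topspace T) {U. openin T U}"
  proof -
    have "W \<subseteq> sets X"
      unfolding W_def
    proof (intro Un_least image_subsetI)
      show "f -` V \<inter> space X \<in> sets X" if "V \<in> \<B>" for V
        by (rule measurable_sets[OF f open_sets[OF \<B>(2)[OF that]]])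
    qed (rule D)
    then show ?thesis unfolding sets .
  qed
  ultimately obtain F g where P: "parametrizes T F g"
    and W: "\<And>B. B \<in> W \<Longrightarrow> open_preimage F g B" "\<And>B. B \<in> W \<Longrightarrow> open_preimage F g (- B)"
    by (rule countable_Borel_clopen_parametrization[OF T(2,3)]) blast
  have img: "g ` F = space X" using parametrizes_image[OF P] T(1) by simp
  define piece where "piece = (\<lambda>a \<alpha> n. (\<lambda>\<beta>. f (g \<beta>)) ` {\<beta> \<in> F. g \<beta> \<in> D a \<and> agree n \<alpha> \<beta>})"
  have piece0: "piece a \<alpha> 0 = f ` D a" if "a \<in> J" for a \<alpha>
  proof -
    have "D a \<subseteq> g ` F" using sets.sets_into_space[OF D[OF that]] img by simp
    then have "D a = g ` {\<beta> \<in> F. g \<beta> \<in> D a}" by blast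
    then have "f ` D a = f ` g ` {\<beta> \<in> F. g \<beta> \<in> D a}" by simp
    then show ?thesis by (simp add: piece_def agree_def image_image)
  qed
  have pieceS: "(\<Union>k. piece a (\<alpha>(n := k)) (Suc n)) = piece a \<alpha> n" for a \<alpha> n
  proof -
    have "agree n \<alpha> \<beta> \<longleftrightarrow> (\<exists>k. agree (Suc n) (\<alpha>(n := k)) \<beta>)" for \<beta>
      by (auto simp: agree_def less_Suc_eq)
    then show ?thesis unfolding piece_def by blast
  qed
  have sepcong: "Borel_separable X J S \<longleftrightarrow> Borel_separable X J S'"
    if "\<And>a. a \<in> J \<Longrightarrow> S a = S' a" for S S'
    using that by (simp add: Borel_separable_def)
  \<comment> \<open>One sequence per index, all lengthened simultaneously, because inseparability is
    a property of the whole family of pieces.\<close>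
  have "\<exists>A. \<forall>n. \<not> Borel_separable X J (\<lambda>a. piece a (A n a) n) \<and> (\<forall>a. agree n (A n a) (A (Suc n) a))"
  proof (rule dependent_nat_choice)
    show "\<exists>A. \<not> Borel_separable X J (\<lambda>a. piece a (A a) 0)"
      using nsep sepcong[of "\<lambda>a. piece a (\<lambda>i. 0) 0" "\<lambda>a. f ` D a"] piece0
      by (intro exI[of _ "\<lambda>a i. 0"]) simp
    fix A n assume A: "\<not> Borel_separable X J (\<lambda>a. piece a (A a) n)"
    then have "\<not> Borel_separable X J (\<lambda>a. \<Union>k. piece a ((A a)(n := k)) (Suc n))"
      by (simp add: pieceS)
    then obtain p where "\<not> Borel_separable X J (\<lambda>a. piece a ((A a)(n := p a)) (Suc n))"
      using Borel_separable_split[OF J, of X "\<lambda>a k. piece a ((A a)(n := k)) (Suc n)"] by blast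
    then show "\<exists>A'. \<not> Borel_separable X J (\<lambda>a. piece a (A' a) (Suc n)) \<and> (\<forall>a. agree n (A a) (A' a))"
      by (intro exI[of _ "\<lambda>a. (A a)(n := p a)"]) (simp add: agree_def)
  qed
  then obtain A where A: "\<And>n. \<not> Borel_separable X J (\<lambda>a. piece a (A n a) n)"
    "\<And>n a. agree n (A n a) (A (Suc n) a)" by blast
  define \<alpha> where "\<alpha> = (\<lambda>a i. A (Suc i) a i)"
  have Aeq: "A m a i = \<alpha> a i" if "i < m" for m a i
    using that
  proof (induction m)
    case (Suc m)
    show ?case
    proof (cases "i = m")
      case False
      then show ?thesis using Suc A(2)[of m a] by (simp add: agree_def)
    qed (simp add: \<alpha>_def)
  qed simp
  have "piece a (A n a) n = piece a (\<alpha> a) n" for a n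
    by (simp add: piece_def agree_def Aeq)
  then have nsepn: "\<not> Borel_separable X J (\<lambda>a. piece a (\<alpha> a) n)" for n
    using A(1)[of n] by simp
  \<comment> \<open>Near the limit there are always parameters of points of \<open>D a\<close>: an
    empty piece would be enclosed in the empty set, and that alone separates the family.\<close>
  have \<alpha>F: "\<alpha> a \<in> {\<beta> \<in> F. g \<beta> \<in> D a}" if a: "a \<in> J" for a
  proof (rule seq_closedD[OF seq_closed_preimage])
    show "seq_closed F" using P by (simp add: parametrizes_def)
    show "open_preimage F g (- D a)" using W(2) a by (simp add: W_def)
    show "\<exists>\<beta>\<in>{\<beta> \<in> F. g \<beta> \<in> D a}. agree n (\<alpha> a) \<beta>" for n
    proof (rule ccontr)
      assume "\<not> ?thesis"
      then have empty: "piece a (\<alpha> a) n = {}" by (auto simp: piece_def)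
      have sp: "piece b \<beta> n \<subseteq> space X" for b \<beta>
        using img measurable_space[OF f] by (auto simp: piece_def)
      have "Borel_separable X J (\<lambda>a. piece a (\<alpha> a) n)"
        unfolding Borel_separable_def
        by (rule exI[of _ "\<lambda>b. if b = a then {} else space X"]) (use a empty sp in auto)
      then show False using nsepn by blast
    qed
  qed
  obtain a where a: "a \<in> J" using J(2) by blast
  have "f (g (\<alpha> a)) \<notin> (\<Inter>b\<in>J. f ` D b)" using disj by simp
  then obtain b where b: "b \<in> J" "f (g (\<alpha> a)) \<notin> f ` D b" by blast
  then have "f (g (\<alpha> a)) \<noteq> f (g (\<alpha> b))" using \<alpha>F[OF b(1)] by blast
  moreover have top: "f (g (\<alpha> c)) \<in> topspace T" if "c \<in> J" for c
    using \<alpha>F[OF that] img measurable_space[OF f] T(1) by auto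
  ultimately obtain U V where UV: "openin T U" "openin T V" "f (g (\<alpha> a)) \<in> U"
    "f (g (\<alpha> b)) \<in> V" "disjnt U V"
    using Haus a b(1) unfolding Hausdorff_space_def by metis
  have near: "\<exists>n. \<forall>m\<ge>n. piece c (\<alpha> c) m \<subseteq> U" if c: "c \<in> J" "openin T U" "f (g (\<alpha> c)) \<in> U" for c U
  proof -
    obtain V where V: "V \<in> \<B>" "f (g (\<alpha> c)) \<in> V" "V \<subseteq> U" using \<B>(3) c by blast
    have "open_preimage F g (f -` V \<inter> space X)" using W(1) V(1) by (simp add: W_def)
    then obtain n where n: "\<And>\<beta>. \<beta> \<in> F \<Longrightarrow> agree n (\<alpha> c) \<beta> \<Longrightarrow> g \<beta> \<in> f -` V \<inter> space X"
      using open_preimageD[of F g _ "\<alpha> c"] \<alpha>F[OF c(1)] V(2) img by blast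
    have "piece c (\<alpha> c) m \<subseteq> U" if "m \<ge> n" for m
    proof
      fix y assume "y \<in> piece c (\<alpha> c) m"
      then obtain \<beta> where \<beta>: "\<beta> \<in> F" "agree m (\<alpha> c) \<beta>" "y = f (g \<beta>)"
        by (auto simp: piece_def)
      show "y \<in> U" using n[OF \<beta>(1) agree_mono[OF \<beta>(2) that]] V(3) \<beta>(3) by blast
    qed
    then show ?thesis by blast
  qed
  obtain n where n: "\<And>m. m \<ge> n \<Longrightarrow> piece a (\<alpha> a) m \<subseteq> U" using near[OF a UV(1,3)] by blast
  obtain n' where n': "\<And>m. m \<ge> n' \<Longrightarrow> piece b (\<alpha> b) m \<subseteq> V" using near[OF b(1) UV(2,4)] by blast
  have "a \<noteq> b" using UV by (auto simp: disjnt_iff)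
  \<comment> \<open>Separating two members is enough; the remaining supersets can be the whole
    space.\<close>
  define C where "C = (\<lambda>c. if c = a then U else if c = b then V else space X)"
  have "Borel_separable X J (\<lambda>a. piece a (\<alpha> a) (max n n'))"
    unfolding Borel_separable_def
  proof (intro exI[of _ C] conjI ballI)
    fix c assume "c \<in> J"
    show "C c \<in> sets X" using UV open_sets by (simp add: C_def)
    have "piece c \<beta> m \<subseteq> space X" for \<beta> m
      using img measurable_space[OF f] by (auto simp: piece_def)
    then show "piece c (\<alpha> c) (max n n') \<subseteq> C c"
      using n[of "max n n'"] n'[of "max n n'"] by (simp add: C_def)
  next
    have "(\<Inter>c\<in>J. C c) \<subseteq> C a \<inter> C b" using a b(1) by blast
    also have "\<dots> = {}" using UV(5) \<open>a \<noteq> b\<close> by (auto simp: C_def disjnt_iff)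
    finally show "(\<Inter>c\<in>J. C c) = {}" by blast
  qed
  then show False using nsepn by blast
qed

section \<open>Finite Borel colourings\<close>

definition fibres_le :: "nat \<Rightarrow> 'x set \<Rightarrow> ('x \<Rightarrow> 'x) \<Rightarrow> bool" where
  "fibres_le k S f \<longleftrightarrow> (\<forall>y\<in>S. finite {x \<in> S. f x = y} \<and> card {x \<in> S. f x = y} \<le> k)"

text \<open>Since the \<open>D a\<close> are disjoint, a point in k + 1 of the images would have k +
  1 preimages. So any k + 1 images have empty intersection and can be separated; intersecting the
  separators over all index sets containing \<open>a\<close> gives Borel supersets of which no point
  meets more than k.\<close>

lemma Borel_multiplicity_cover:
  assumes X: "standard_borel X" and f: "f \<in> X \<rightarrow>\<^sub>M X" and k: "fibres_le k (space X) f"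
    and D: "\<And>a. D a \<in> sets X" and disj: "\<And>a b. a \<noteq> b \<Longrightarrow> D a \<inter> D b = {}"
  shows "\<exists>C. (\<forall>a. C a \<in> sets X) \<and> (\<forall>a<l. f ` D a \<subseteq> C a) \<and>
    (\<forall>y. card {a. a < (l::nat) \<and> y \<in> C a} \<le> k)"
proof -
  define \<J> where "\<J> = {J. J \<subseteq> {..<l} \<and> card J = Suc k}"
  have fin: "finite \<J>" by (simp add: \<J>_def)
  have "\<exists>C. (\<forall>a\<in>J. C a \<in> sets X \<and> f ` D a \<subseteq> C a) \<and> (\<Inter>a\<in>J. C a) = {}" if J: "J \<in> \<J>" for J
  proof -
    have J': "finite J" "card J = Suc k"
      using J by (auto simp: \<J>_def intro: finite_subset)
    then have ne: "J \<noteq> {}" by auto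
    have "(\<Inter>a\<in>J. f ` D a) = {}"
    proof (rule ccontr)
      assume "(\<Inter>a\<in>J. f ` D a) \<noteq> {}"
      then obtain y where "\<forall>a\<in>J. y \<in> f ` D a" by blast
      then have "\<forall>a\<in>J. \<exists>x. x \<in> D a \<and> f x = y" by blast
      from bchoice[OF this] obtain x where x: "\<And>a. a \<in> J \<Longrightarrow> x a \<in> D a \<and> f (x a) = y"
        by blast
      have "inj_on x J"
        using x disj by (intro inj_onI) (metis disjoint_iff)
      have sub: "x ` J \<subseteq> {z \<in> space X. f z = y}"
        using x sets.sets_into_space[OF D] by blast
      obtain a where "a \<in> J" using ne by blast
      then have "y \<in> space X"
        using x sets.sets_into_space[OF D] measurable_space[OF f] by blast
      then have "finite {z \<in> space X. f z = y}" "card {z \<in> space X. f z = y} \<le> k"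
        using k by (simp_all add: fibres_le_def)
      then have "card (x ` J) \<le> k" using card_mono[OF _ sub] by linarith
      then show False using card_image[OF \<open>inj_on x J\<close>] J'(2) by simp
    qed
    then show ?thesis
      using Borel_images_separable[OF X f J'(1) ne D] by (simp add: Borel_separable_def)
  qed
  then have "\<forall>J\<in>\<J>. \<exists>C. (\<forall>a\<in>J. C a \<in> sets X \<and> f ` D a \<subseteq> C a) \<and> (\<Inter>a\<in>J. C a) = {}"
    by blast
  from bchoice[OF this] obtain C
    where CC: "\<forall>J\<in>\<J>. (\<forall>a\<in>J. C J a \<in> sets X \<and> f ` D a \<subseteq> C J a) \<and> (\<Inter>a\<in>J. C J a) = {}" ..
  have C: "C J a \<in> sets X" "f ` D a \<subseteq> C J a" if "J \<in> \<J>" "a \<in> J" for J a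
    using bspec[OF CC that(1)] that(2) by simp_all
  have C0: "(\<Inter>a\<in>J. C J a) = {}" if "J \<in> \<J>" for J
    using bspec[OF CC that] by (rule conjunct2)
  define C' where "C' = (\<lambda>a. {y \<in> space X. \<forall>J\<in>\<J>. a \<in> J \<longrightarrow> y \<in> C J a})"
  show ?thesis
  proof (intro exI[of _ C'] conjI allI impI)
    show "C' a \<in> sets X" for a
      unfolding C'_def
    proof (rule sets.sets_Collect_finite_All[OF _ fin])
      fix J assume "J \<in> \<J>"
      then show "{y \<in> space X. a \<in> J \<longrightarrow> y \<in> C J a} \<in> sets X"
        using C(1)[of J a] by (cases "a \<in> J") (simp_all add: sets.Int_space_eq1[symmetric] Int_def)
    qed
    show "f ` D a \<subseteq> C' a" for a
      using C(2)[of _ a] measurable_space[OF f] sets.sets_into_space[OF D, of a]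
      by (auto simp: C'_def)
    show "card {a. a < l \<and> y \<in> C' a} \<le> k" for y
    proof (rule ccontr)
      assume "\<not> ?thesis"
      then have "Suc k \<le> card {a. a < l \<and> y \<in> C' a}" by simp
      then obtain J where J: "J \<subseteq> {a. a < l \<and> y \<in> C' a}" "card J = Suc k"
        by (meson obtain_subset_with_card_n)
      then have "J \<in> \<J>" by (auto simp: \<J>_def)
      moreover from this have "y \<in> C J a" if "a \<in> J" for a
        using J(1) that by (auto simp: C'_def)
      ultimately show False using C0[of J] by blast
    qed
  qed
qed

text \<open>A finite symmetric family of pairs \<open>(u, v)\<close> of maps stands for the graph in which \<open>z\<close> and
  \<open>z'\<close> are adjacent iff \<open>u z = v z'\<close> for one of the pairs.\<close>

definition proper_on :: "('x \<Rightarrow> nat) \<Rightarrow> (('x \<Rightarrow> 'x) \<times> ('x \<Rightarrow> 'x)) set \<Rightarrow> 'x set \<Rightarrow> bool" where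
  "proper_on \<phi> \<F> S \<longleftrightarrow> (\<forall>z\<in>S. \<forall>z'\<in>S. \<forall>u v. (u, v) \<in> \<F> \<longrightarrow> u z = v z' \<longrightarrow> \<phi> z \<noteq> \<phi> z')"

text \<open>A colour is forbidden at z in \<open>B\<close> if \<open>u z\<close> lies in the Borel
  superset of the \<open>v\<close>-image of the points of \<open>W\<close> with that colour.
  Supersets can only forbid too much, and each pair forbids at most k colours, so one of the l
  colours remains. Conflicts inside \<open>B\<close> are excluded by its independence.\<close>

lemma extend_Borel_coloring:
  assumes X: "standard_borel X" and \<F>: "finite \<F>" and sym: "\<And>u v. (u, v) \<in> \<F> \<Longrightarrow> (v, u) \<in> \<F>"
    and meas: "\<And>u v. (u, v) \<in> \<F> \<Longrightarrow> v \<in> X \<rightarrow>\<^sub>M X"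
    and k: "\<And>u v. (u, v) \<in> \<F> \<Longrightarrow> fibres_le k (space X) v"
    and l: "card \<F> * k < l"
    and WB: "W \<in> sets X" "B \<in> sets X"
    and \<phi>: "\<phi> \<in> X \<rightarrow>\<^sub>M count_space UNIV" "\<And>z. \<phi> z < l" "proper_on \<phi> \<F> W"
    and B: "\<And>z z' u v. z \<in> B \<Longrightarrow> z' \<in> B \<Longrightarrow> (u, v) \<in> \<F> \<Longrightarrow> u z \<noteq> v z'"
  shows "\<exists>\<phi>'. (\<phi>' \<in> X \<rightarrow>\<^sub>M count_space UNIV \<and> (\<forall>z. \<phi>' z < l) \<and> proper_on \<phi>' \<F> (W \<union> B)) \<and>
    (\<forall>z\<in>W. \<phi>' z = \<phi> z)"
proof -
  have u: "u \<in> X \<rightarrow>\<^sub>M X" if "(u, v) \<in> \<F>" for u v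
    using meas[OF sym[OF that]] .
  define D where "D = (\<lambda>a. W \<inter> (\<phi> -` {a} \<inter> space X))"
  have D: "D a \<in> sets X" for a
    unfolding D_def by (intro sets.Int WB(1) measurable_sets[OF \<phi>(1)]) simp
  have "\<forall>p\<in>\<F>. \<exists>C. (\<forall>a. C a \<in> sets X) \<and> (\<forall>a<l. snd p ` D a \<subseteq> C a) \<and>
      (\<forall>y. card {a. a < l \<and> y \<in> C a} \<le> k)"
  proof
    fix p assume "p \<in> \<F>"
    obtain u v where p: "p = (u, v)" by force
    then have uv: "(u, v) \<in> \<F>" using \<open>p \<in> \<F>\<close> by simp
    have disj: "D a \<inter> D b = {}" if "a \<noteq> b" for a b using that by (auto simp: D_def)
    show "\<exists>C. (\<forall>a. C a \<in> sets X) \<and> (\<forall>a<l. snd p ` D a \<subseteq> C a) \<and>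
        (\<forall>y. card {a. a < l \<and> y \<in> C a} \<le> k)"
      using Borel_multiplicity_cover[where l = l and D = D, OF X meas[OF uv] k[OF uv] D disj]
      unfolding p snd_conv .
  qed
  from bchoice[OF this] obtain C where CC: "\<forall>p\<in>\<F>. (\<forall>a. C p a \<in> sets X) \<and>
      (\<forall>a<l. snd p ` D a \<subseteq> C p a) \<and> (\<forall>y. card {a. a < l \<and> y \<in> C p a} \<le> k)" ..
  have C: "C p a \<in> sets X" "a < l \<Longrightarrow> snd p ` D a \<subseteq> C p a" "card {a. a < l \<and> y \<in> C p a} \<le> k"
    if "p \<in> \<F>" for p a y
    using bspec[OF CC that] by simp_all
  define forb where "forb = (\<lambda>z. {a. a < l \<and> (\<exists>p\<in>\<F>. fst p z \<in> C p a)})"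
  define \<phi>' where "\<phi>' = (\<lambda>z. if z \<in> W then \<phi> z else if z \<in> B then LEAST a. a \<notin> forb z else \<phi> z)"
  have ex: "\<exists>a<l. a \<notin> forb z" for z
  proof (rule ccontr)
    assume "\<not> ?thesis"
    then have "{..<l} \<subseteq> (\<Union>p\<in>\<F>. {a. a < l \<and> fst p z \<in> C p a})"
      by (auto simp: forb_def)
    then have "card {..<l} \<le> card (\<Union>p\<in>\<F>. {a. a < l \<and> fst p z \<in> C p a})"
      by (rule card_mono[rotated]) (use \<F> in simp)
    also have "\<dots> \<le> (\<Sum>p\<in>\<F>. card {a. a < l \<and> fst p z \<in> C p a})"
      by (rule card_UN_le[OF \<F>])
    also have "\<dots> \<le> card \<F> * k"
      using sum_bounded_above[of \<F> "\<lambda>p. card {a. a < l \<and> fst p z \<in> C p a}" k] C(3) by simp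
    finally show False using l by simp
  qed
  have least: "(LEAST a. a \<notin> forb z) < l" "(LEAST a. a \<notin> forb z) \<notin> forb z" for z
  proof -
    obtain a where a: "a < l" "a \<notin> forb z" using ex by blast
    show "(LEAST a. a \<notin> forb z) < l"
      using Least_le[of "\<lambda>a. a \<notin> forb z", OF a(2)] a(1) by simp
    show "(LEAST a. a \<notin> forb z) \<notin> forb z"
      using LeastI[of "\<lambda>a. a \<notin> forb z", OF a(2)] .
  qed
  show ?thesis
  proof (intro exI[of _ \<phi>'] conjI allI ballI)
    have "Measurable.pred X (\<lambda>z. a \<notin> forb z)" for a
    proof -
      have "Measurable.pred X (\<lambda>z. fst p z \<in> C p a)" if "p \<in> \<F>" for p
        using that C(1)[OF that] u[of "fst p" "snd p"] by (intro pred_sets2) simp_all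
      then show ?thesis
        unfolding forb_def using \<F> by simp
    qed
    then have "(\<lambda>z. LEAST a. a \<notin> forb z) \<in> X \<rightarrow>\<^sub>M count_space UNIV"
      by (rule measurable_Least)
    then show "\<phi>' \<in> X \<rightarrow>\<^sub>M count_space UNIV"
      unfolding \<phi>'_def using WB \<phi>(1) by (intro measurable_If_set) (auto intro: sets.Int)
    show "\<phi>' z < l" for z
      using \<phi>(2) least(1) by (simp add: \<phi>'_def)
    show "\<phi>' z = \<phi> z" if "z \<in> W" for z
      using that by (simp add: \<phi>'_def)
    have mixed: "\<phi>' z \<noteq> \<phi>' z'" if z: "z \<in> B - W" "z' \<in> W" "(u, v) \<in> \<F>" "u z = v z'" for z z' u v
    proof -
      have "z' \<in> D (\<phi> z')" using z(2) WB sets.sets_into_space by (auto simp: D_def)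
      then have "v z' \<in> C (u, v) (\<phi> z')"
        using C(2)[OF z(3) \<phi>(2)[of z']] by (simp add: image_subset_iff)
      then have "fst (u, v) z \<in> C (u, v) (\<phi> z')" using z(4) by simp
      then have "\<phi> z' \<in> forb z"
        unfolding forb_def using z(3) \<phi>(2) by blast
      then show ?thesis using least(2)[of z] z by (auto simp: \<phi>'_def)
    qed
    show "proper_on \<phi>' \<F> (W \<union> B)"
      unfolding proper_on_def
    proof (clarify)
      fix z z' u v
      assume *: "z \<in> W \<union> B" "z' \<in> W \<union> B" "(u, v) \<in> \<F>" "u z = v z'" "\<phi>' z = \<phi>' z'"
      \<comment> \<open>A conflict between an old and a new point is always read at the new one; the
        third case does so through the reversed pair.\<close>
      consider "z \<in> W" "z' \<in> W" | "z \<in> B - W" "z' \<in> W" | "z \<in> W" "z' \<in> B - W" | "z \<in> B" "z' \<in> B"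
        using * by blast
      then show False
      proof cases
        case 1
        then have "\<phi> z \<noteq> \<phi> z'" using \<phi>(3) * unfolding proper_on_def by blast
        then show False using * 1 by (simp add: \<phi>'_def)
      next
        case 2
        then show False using mixed * by metis
      next
        case 3
        then show False using mixed sym * by metis
      next
        case 4
        then show False using B * by metis
      qed
    qed
  qed
qed

text \<open>The classes of the countable colouring \<psi> are independent, so they can be added one
  at a time; the number of colours required does not depend on the step, and colours once given are
  kept.\<close>

theorem finite_Borel_coloring:
  assumes X: "standard_borel X" and \<F>: "finite \<F>" and sym: "\<And>u v. (u, v) \<in> \<F> \<Longrightarrow> (v, u) \<in> \<F>"
    and meas: "\<And>u v. (u, v) \<in> \<F> \<Longrightarrow> v \<in> X \<rightarrow>\<^sub>M X"
    and k: "\<And>u v. (u, v) \<in> \<F> \<Longrightarrow> fibres_le k (space X) v"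
    and \<psi>: "\<psi> \<in> X \<rightarrow>\<^sub>M count_space UNIV" "proper_on \<psi> \<F> (space X)"
  obtains \<phi> l where "\<phi> \<in> X \<rightarrow>\<^sub>M count_space UNIV" "\<And>z. \<phi> z < (l::nat)" "proper_on \<phi> \<F> (space X)"
proof -
  define l where "l = Suc (card \<F> * k)"
  define W where "W = (\<lambda>n. {z \<in> space X. \<psi> z < n})"
  define B where "B = (\<lambda>n. {z \<in> space X. \<psi> z = n})"
  have W: "W n \<in> sets X" and B: "B n \<in> sets X" for n
    using \<psi>(1) unfolding W_def B_def by measurable
  have WB: "W (Suc n) = W n \<union> B n" for n by (auto simp: W_def B_def)
  have "\<exists>\<Phi>. \<forall>n. (\<Phi> n \<in> X \<rightarrow>\<^sub>M count_space UNIV \<and> (\<forall>z. \<Phi> n z < l) \<and> proper_on (\<Phi> n) \<F> (W n)) \<and>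
      (\<forall>z\<in>W n. \<Phi> (Suc n) z = \<Phi> n z)"
  proof (rule dependent_nat_choice)
    show "\<exists>\<phi>. \<phi> \<in> X \<rightarrow>\<^sub>M count_space UNIV \<and> (\<forall>z. \<phi> z < l) \<and> proper_on \<phi> \<F> (W 0)"
      by (intro exI[of _ "\<lambda>z. 0"]) (simp add: l_def proper_on_def W_def)
    fix \<phi> n assume \<phi>: "\<phi> \<in> X \<rightarrow>\<^sub>M count_space UNIV \<and> (\<forall>z. \<phi> z < l) \<and> proper_on \<phi> \<F> (W n)"
    have indep: "u z \<noteq> v z'" if "z \<in> B n" "z' \<in> B n" "(u, v) \<in> \<F>" for z z' u v
    proof
      assume "u z = v z'"
      then have "\<psi> z \<noteq> \<psi> z'" using \<psi>(2) that unfolding proper_on_def B_def by blast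
      then show False using that by (simp add: B_def)
    qed
    show "\<exists>\<phi>'. (\<phi>' \<in> X \<rightarrow>\<^sub>M count_space UNIV \<and> (\<forall>z. \<phi>' z < l) \<and> proper_on \<phi>' \<F> (W (Suc n))) \<and>
        (\<forall>z\<in>W n. \<phi>' z = \<phi> z)"
      unfolding WB
    proof (rule extend_Borel_coloring[OF X \<F> sym])
      show "card \<F> * k < l" by (simp add: l_def)
    qed (use \<phi> meas k W B indep in auto)
  qed
  then obtain \<Phi> where \<Phi>: "\<And>n. \<Phi> n \<in> X \<rightarrow>\<^sub>M count_space UNIV" "\<And>n z. \<Phi> n z < l"
    "\<And>n. proper_on (\<Phi> n) \<F> (W n)" "\<And>n z. z \<in> W n \<Longrightarrow> \<Phi> (Suc n) z = \<Phi> n z"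
    by blast
  \<comment> \<open>The colour of z is settled as soon as its class \<open>\<psi> z\<close> has been
    added.\<close>
  define \<phi> where "\<phi> = (\<lambda>z. \<Phi> (Suc (\<psi> z)) z)"
  have eq: "\<Phi> n z = \<phi> z" if "z \<in> space X" "\<psi> z < n" for n z
    using that(2)
  proof (induction n)
    case (Suc n)
    show ?case
    proof (cases "\<psi> z = n")
      case False
      then have "z \<in> W n" using Suc.prems that(1) by (simp add: W_def)
      then show ?thesis using \<Phi>(4) Suc False by simp
    qed (simp add: \<phi>_def)
  qed simp
  show ?thesis
  proof
    show "\<phi> \<in> X \<rightarrow>\<^sub>M count_space UNIV"
      unfolding \<phi>_def
      by (rule measurable_compose_countable[of "\<lambda>n. \<Phi> (Suc n)", OF \<Phi>(1) \<psi>(1)])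
    show "\<phi> z < l" for z using \<Phi>(2) by (simp add: \<phi>_def)
    show "proper_on \<phi> \<F> (space X)"
      unfolding proper_on_def
    proof clarify
      fix z z' u v
      assume *: "z \<in> space X" "z' \<in> space X" "(u, v) \<in> \<F>" "u z = v z'" "\<phi> z = \<phi> z'"
      define n where "n = Suc (max (\<psi> z) (\<psi> z'))"
      have "\<psi> z < n" "\<psi> z' < n" by (simp_all add: n_def)
      then have "z \<in> W n" "z' \<in> W n" "\<Phi> n z = \<Phi> n z'" using * eq by (simp_all add: W_def)
      then show False using \<Phi>(3)[of n] *(3,4) unfolding proper_on_def by blast
    qed
  qed
qed

section \<open>Marker sets in forward orbits\<close>

text \<open>A countable basis works, because finite sets are closed in a Hausdorff space.\<close>

lemma countable_Borel_separating_family: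
  assumes "standard_borel X"
  obtains U :: "nat \<Rightarrow> 'x set" where "\<And>i. U i \<in> sets X"
    "\<And>y A. y \<in> space X \<Longrightarrow> finite A \<Longrightarrow> y \<notin> A \<Longrightarrow> \<exists>i. y \<in> U i \<and> A \<inter> U i = {}"
proof -
  obtain T where T: "topspace T = space X" "completely_metrizable_space T" "second_countable T"
    and sets: "sets X = sigma_sets (topspace T) {U. openin T U}"
    using assms unfolding standard_borel_def by metis
  have Haus: "Hausdorff_space T"
    using T(2) by (simp add: completely_metrizable_imp_metrizable_space metrizable_imp_Hausdorff_space)
  obtain \<B> where \<B>: "countable \<B>" "\<And>V. V \<in> \<B> \<Longrightarrow> openin T V"
    "\<And>U x. openin T U \<Longrightarrow> x \<in> U \<Longrightarrow> \<exists>V\<in>\<B>. x \<in> V \<and> V \<subseteq> U"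
    using T(3) unfolding second_countable_def by metis
  define U where "U = from_nat_into (insert {} \<B>)"
  have ran: "range U = insert {} \<B>"
    using \<B>(1) by (simp add: U_def)
  show ?thesis
  proof
    fix i
    have "U i \<in> insert {} \<B>" using ran by blast
    then show "U i \<in> sets X"
      using \<B>(2) unfolding sets by (auto intro: sigma_sets.Basic sigma_sets.Empty)
  next
    fix y A assume y: "y \<in> space X" "finite A" "y \<notin> A"
    have "closedin T (A \<inter> topspace T)"
      using y(2) Haus by (intro closedin_Hausdorff_finite) auto
    then have "openin T (topspace T - A \<inter> topspace T)" by blast
    then obtain V where V: "V \<in> \<B>" "y \<in> V" "V \<subseteq> topspace T - A \<inter> topspace T"
      using \<B>(3) y T(1) by (metis DiffI IntD1)
    then obtain i where "U i = V" using ran by (metis insertCI rangeE)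
    then show "\<exists>i. y \<in> U i \<and> A \<inter> U i = {}" using V by blast
  qed
qed

text \<open>The colour of \<open>z\<close> describes \<open>g \<gamma> z\<close> relative to the points \<open>g m z\<close> instead of describing \<open>z\<close>
  itself; it is then determined by preimages of Borel sets, and no images of Borel sets occur.\<close>

lemma countable_Borel_coloring:
  assumes X: "standard_borel X" and K: "finite K"
    and meas: "\<And>m. m \<in> insert \<gamma> K \<Longrightarrow> g m \<in> X \<rightarrow>\<^sub>M X"
    and free: "\<And>m z. m \<in> K \<Longrightarrow> z \<in> space X \<Longrightarrow> g m z \<noteq> g \<gamma> z"
  obtains \<psi> :: "'x \<Rightarrow> nat" where "\<psi> \<in> X \<rightarrow>\<^sub>M count_space UNIV"
    "\<And>m z z'. m \<in> K \<Longrightarrow> z \<in> space X \<Longrightarrow> z' \<in> space X \<Longrightarrow> g m z = g \<gamma> z' \<Longrightarrow> \<psi> z \<noteq> \<psi> z'"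
proof -
  obtain U :: "nat \<Rightarrow> 'x set" where U: "\<And>i. U i \<in> sets X"
    "\<And>y A. y \<in> space X \<Longrightarrow> finite A \<Longrightarrow> y \<notin> A \<Longrightarrow> \<exists>i. y \<in> U i \<and> A \<inter> U i = {}"
    by (rule countable_Borel_separating_family[OF X]) blast
  \<comment> \<open>If \<open>g m z = g \<gamma> z'\<close> and both points had colour i, this
    common value would lie in \<open>U i\<close> on account of z' and outside it on account of
    z.\<close>
  define Q where "Q = (\<lambda>z i. g \<gamma> z \<in> U i \<and> (\<forall>m\<in>K. g m z \<notin> U i))"
  define \<psi> where "\<psi> = (\<lambda>z. LEAST i. Q z i)"
  have Q: "Q z (\<psi> z)" if z: "z \<in> space X" for z
  proof -
    have "g \<gamma> z \<in> space X" using measurable_space[OF meas z] by simp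
    moreover have "g \<gamma> z \<notin> (\<lambda>m. g m z) ` K" using free z by fastforce
    ultimately obtain i where "g \<gamma> z \<in> U i" "(\<lambda>m. g m z) ` K \<inter> U i = {}"
      using U(2)[of "g \<gamma> z" "(\<lambda>m. g m z) ` K"] K by blast
    then have "Q z i" by (auto simp: Q_def)
    then show ?thesis unfolding \<psi>_def by (rule LeastI)
  qed
  show ?thesis
  proof
    have pred: "Measurable.pred X (\<lambda>z. g m z \<in> U i)" if "m \<in> insert \<gamma> K" for m i
      by (rule pred_sets2[OF U(1) meas[OF that]])
    have "Measurable.pred X (\<lambda>z. \<forall>m\<in>K. g m z \<notin> U i)" for i
      using K pred by (intro pred_intros_finite pred_intros_logic) auto
    then have "Measurable.pred X (\<lambda>z. Q z i)" for i
      unfolding Q_def using pred by (intro pred_intros_logic) auto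
    then show "\<psi> \<in> X \<rightarrow>\<^sub>M count_space UNIV"
      unfolding \<psi>_def by (rule measurable_Least)
    fix m z z' assume *: "m \<in> K" "z \<in> space X" "z' \<in> space X" "g m z = g \<gamma> z'"
    show "\<psi> z \<noteq> \<psi> z'"
    proof
      assume "\<psi> z = \<psi> z'"
      then have "Q z (\<psi> z)" "Q z' (\<psi> z)" using Q[OF *(2)] Q[OF *(3)] by simp_all
      then show False using *(1,4) by (auto simp: Q_def)
    qed
  qed
qed

text \<open>A greedy selection over the colours. Membership of \<open>x\<close> in \<open>P j\<close> means that, as seen from
  \<open>x\<close>, the point \<open>(g \<gamma> ^^ j) x\<close> has been selected before stage \<open>j\<close>; shifting by \<open>g \<gamma>\<close> at every
  stage keeps all the points to be inspected inside forward orbits.\<close>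

lemma forward_marker_set_of_coloring:
  assumes K: "finite K" "\<gamma> \<in> K" and meas: "\<And>m. m \<in> K \<Longrightarrow> g m \<in> X \<rightarrow>\<^sub>M X"
    and comm: "\<And>m z. m \<in> K \<Longrightarrow> z \<in> space X \<Longrightarrow> g m (g \<gamma> z) = g \<gamma> (g m z)"
    and \<phi>: "\<phi> \<in> X \<rightarrow>\<^sub>M count_space UNIV" "\<And>z. \<phi> z < (l::nat)"
    and proper: "\<And>m z z'. m \<in> K - {\<gamma>} \<Longrightarrow> z \<in> space X \<Longrightarrow> z' \<in> space X \<Longrightarrow>
      g m z = g \<gamma> z' \<Longrightarrow> \<phi> z \<noteq> \<phi> z'"
  obtains P where "P \<in> sets X" "\<And>x. x \<in> space X \<Longrightarrow> \<exists>m\<in>K. g m x \<in> P"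
    "\<And>y y' m m'. y \<in> P \<Longrightarrow> y' \<in> P \<Longrightarrow> m \<in> K - {\<gamma>} \<Longrightarrow> m' \<in> K - {\<gamma>} \<Longrightarrow>
      g m y = g \<gamma> y' \<Longrightarrow> g m' y' = g \<gamma> y \<Longrightarrow> False"
proof -
  define h where "h = g \<gamma>"
  \<comment> \<open>A neighbour y' of x, with \<open>g m x = h y'\<close>, is tested through
    \<open>g m x\<close>: by the first alternative \<open>h y'\<close> in stage j puts y' into stage
    j + 1, and y' itself need not lie in the forward orbit of x.\<close>
  define P where "P = rec_nat {} (\<lambda>j S. {x \<in> space X. h x \<in> S \<or>
    \<phi> ((h ^^ j) x) = j \<and> (\<forall>m\<in>K - {\<gamma>}. g m x \<notin> S)})"
  have P0: "P 0 = {}" by (simp add: P_def)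
  have PS: "P (Suc j) = {x \<in> space X. h x \<in> P j \<or>
    \<phi> ((h ^^ j) x) = j \<and> (\<forall>m\<in>K - {\<gamma>}. g m x \<notin> P j)}" for j
    by (simp add: P_def)
  have h: "h \<in> X \<rightarrow>\<^sub>M X" using meas[OF K(2)] by (simp add: h_def)
  have hn: "h ^^ j \<in> X \<rightarrow>\<^sub>M X" for j
  proof (induction j)
    case (Suc j)
    show ?case unfolding funpow.simps by (rule measurable_comp[OF Suc h])
  qed (simp add: id_def)
  have sp: "(h ^^ j) x \<in> space X" if "x \<in> space X" for j x
    using measurable_space[OF hn that] .
  have gsp: "g m x \<in> space X" if "m \<in> K" "x \<in> space X" for m x
    using measurable_space[OF meas[OF that(1)] that(2)] .
  have commn: "g m ((h ^^ i) z) = (h ^^ i) (g m z)" if "m \<in> K" "z \<in> space X" for m i z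
  proof (induction i)
    case (Suc i)
    then show ?case using comm[OF that(1) sp[OF that(2), of i]] by (simp add: h_def)
  qed simp
  have Psets: "P j \<in> sets X" for j
  proof (induction j)
    case (Suc j)
    have pred: "Measurable.pred X (\<lambda>z. g m z \<in> P j)" if "m \<in> K" for m
      by (rule pred_sets2[OF Suc meas[OF that]])
    have "Measurable.pred X (\<lambda>z. \<forall>m\<in>K - {\<gamma>}. g m z \<notin> P j)"
      using K pred by (intro pred_intros_finite pred_intros_logic) auto
    moreover have "Measurable.pred X (\<lambda>x. \<phi> ((h ^^ j) x) = j)"
      using measurable_compose[OF hn[of j] \<phi>(1)] by simp
    moreover have "Measurable.pred X (\<lambda>x. h x \<in> P j)"
      using pred[OF K(2)] by (simp add: h_def)
    ultimately have "Measurable.pred X (\<lambda>x. h x \<in> P j \<or>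
        \<phi> ((h ^^ j) x) = j \<and> (\<forall>m\<in>K - {\<gamma>}. g m x \<notin> P j))"
      by (intro pred_intros_logic)
    then show ?case unfolding PS by (simp add: pred_def)
  qed (simp add: P0)
  have up: "y \<in> P (j + i)" if "y \<in> space X" "(h ^^ i) y \<in> P j" for y i j
    using that
  proof (induction i arbitrary: y)
    case (Suc i)
    then have "h y \<in> P (j + i)"
      using measurable_space[OF h] by (simp add: funpow_swap1)
    then show ?case using Suc.prems by (simp add: PS)
  qed simp
  have cover: "\<exists>m\<in>K. g m x \<in> P l" if x: "x \<in> space X" for x
  proof -
    define j where "j = \<phi> ((h ^^ l) x)"
    have j: "j < l" using \<phi>(2) by (simp add: j_def)
    define u where "u = (h ^^ (l - j)) x"
    have u: "u \<in> space X" using sp x by (simp add: u_def)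
    have hu: "u = (h ^^ (l - Suc j)) (h x)"
    proof -
      have "u = (h ^^ Suc (l - Suc j)) x" using j by (simp add: u_def Suc_diff_Suc)
      then show ?thesis by (simp only: funpow_Suc_right comp_def)
    qed
    show ?thesis
    proof (cases "\<forall>m\<in>K - {\<gamma>}. g m u \<notin> P j")
      case True
      have "(h ^^ j) u = (h ^^ l) x"
        using j funpow_add[of j "l - j" h] by (simp add: u_def)
      then have "u \<in> P (Suc j)" using True u by (simp add: PS j_def)
      then have "h x \<in> P (Suc j + (l - Suc j))"
        unfolding hu by (rule up[OF measurable_space[OF h x]])
      then show ?thesis using j K(2) by (auto simp: h_def)
    next
      case False
      then obtain m where m: "m \<in> K" "g m u \<in> P j" by blast
      then have "(h ^^ (l - j)) (g m x) \<in> P j" using commn[OF m(1) x] by (simp add: u_def)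
      then have "g m x \<in> P (j + (l - j))" by (rule up[OF gsp[OF m(1) x]])
      then show ?thesis using j m(1) by auto
    qed
  qed
  \<comment> \<open>Every element of \<open>P l\<close> goes back to an admission by the second
    alternative; the least index from which it was carried along tells the stage.\<close>
  have new: "\<exists>i<l. \<phi> ((h ^^ (l - 1)) y) = i \<and> (h ^^ (l - Suc i)) y \<in> P (Suc i) \<and>
      (\<forall>m\<in>K - {\<gamma>}. g m ((h ^^ (l - Suc i)) y) \<notin> P i)" if y: "y \<in> P l" for y
  proof -
    define n where "n = (LEAST i. (h ^^ (l - i)) y \<in> P i)"
    have n: "(h ^^ (l - n)) y \<in> P n"
      unfolding n_def by (rule LeastI[of _ l]) (use y in simp)
    have nl: "n \<le> l" unfolding n_def by (rule Least_le) (use y in simp)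
    obtain i where i: "n = Suc i" using n P0 by (cases n) auto
    have not: "(h ^^ (l - i)) y \<notin> P i"
      using not_less_Least[of i "\<lambda>i. (h ^^ (l - i)) y \<in> P i"] i by (simp add: n_def)
    have "h ((h ^^ (l - n)) y) = (h ^^ (l - i)) y"
    proof -
      have "l - i = Suc (l - n)" using nl i by simp
      then show ?thesis by simp
    qed
    moreover have "(h ^^ i) ((h ^^ (l - n)) y) = (h ^^ (l - 1)) y"
      using funpow_add[of i "l - n" h] nl i by simp
    ultimately have "\<phi> ((h ^^ (l - 1)) y) = i" "\<forall>m\<in>K - {\<gamma>}. g m ((h ^^ (l - n)) y) \<notin> P i"
      using n not by (simp_all add: i PS)
    then show ?thesis using n nl i by auto
  qed
  have later: False if y: "y \<in> space X" "y' \<in> space X" and m: "m \<in> K - {\<gamma>}" "g m y = h y'"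
    and i: "i' < i" "i < l" "(h ^^ (l - Suc i')) y' \<in> P (Suc i')"
      "\<forall>m\<in>K - {\<gamma>}. g m ((h ^^ (l - Suc i)) y) \<notin> P i" for y y' m i i'
  proof -
    have "(h ^^ (i - Suc i')) ((h ^^ (l - i)) y') = (h ^^ (l - Suc i')) y'"
      using funpow_add[of "i - Suc i'" "l - i" h] i by simp
    then have "(h ^^ (l - i)) y' \<in> P (Suc i' + (i - Suc i'))"
      using i(3) by (intro up sp y) simp
    moreover have "Suc i' + (i - Suc i') = i" using i(1) by simp
    moreover have "g m ((h ^^ (l - Suc i)) y) = (h ^^ (l - i)) y'"
    proof -
      have "g m ((h ^^ (l - Suc i)) y) = (h ^^ (l - Suc i)) (h y')"
        using commn[of m y] m y by simp
      also have "\<dots> = (h ^^ Suc (l - Suc i)) y'" by (simp only: funpow_Suc_right comp_def)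
      also have "Suc (l - Suc i) = l - i" using i by simp
      finally show ?thesis .
    qed
    ultimately show False using bspec[OF i(4) m(1)] by metis
  qed
  show ?thesis
  proof
    show "P l \<in> sets X" by (rule Psets)
    show "\<exists>m\<in>K. g m x \<in> P l" if "x \<in> space X" for x using cover that .
    fix y y' m m'
    assume *: "y \<in> P l" "y' \<in> P l" "m \<in> K - {\<gamma>}" "m' \<in> K - {\<gamma>}" "g m y = g \<gamma> y'" "g m' y' = g \<gamma> y"
    have y: "y \<in> space X" "y' \<in> space X" using * sets.sets_into_space[OF Psets] by blast+
    obtain i where i: "i < l" "\<phi> ((h ^^ (l - 1)) y) = i" "(h ^^ (l - Suc i)) y \<in> P (Suc i)"
      "\<forall>m\<in>K - {\<gamma>}. g m ((h ^^ (l - Suc i)) y) \<notin> P i"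
      using new[OF *(1)] by blast
    obtain i' where i': "i' < l" "\<phi> ((h ^^ (l - 1)) y') = i'" "(h ^^ (l - Suc i')) y' \<in> P (Suc i')"
      "\<forall>m\<in>K - {\<gamma>}. g m ((h ^^ (l - Suc i')) y') \<notin> P i'"
      using new[OF *(2)] by blast
    consider "i' < i" | "i < i'" | "i = i'" by linarith
    then show False
    proof cases
      case 1
      show False by (rule later[of y y' m i' i]) (use y * i i' 1 in \<open>simp_all add: h_def\<close>)
    next
      case 2
      show False by (rule later[of y' y m' i i']) (use y * i i' 2 in \<open>simp_all add: h_def\<close>)
    next
      case 3
      \<comment> \<open>Admission at the same stage means equal colours, although the shifted points
        are still adjacent.\<close>
      have "g m ((h ^^ (l - 1)) y) = (h ^^ (l - 1)) (h y')"
        using commn[of m y] * y by (simp add: h_def)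
      also have "\<dots> = h ((h ^^ (l - 1)) y')" by (simp add: funpow_swap1)
      finally have "\<phi> ((h ^^ (l - 1)) y) \<noteq> \<phi> ((h ^^ (l - 1)) y')"
        by (intro proper[OF *(3)] sp y) (simp add: h_def)
      then show False using i(2) i'(2) 3 by simp
    qed
  qed
qed

theorem forward_marker_set:
  assumes X: "standard_borel X" and K: "finite K" "\<gamma> \<in> K"
    and meas: "\<And>m. m \<in> K \<Longrightarrow> g m \<in> X \<rightarrow>\<^sub>M X"
    and comm: "\<And>m z. m \<in> K \<Longrightarrow> z \<in> space X \<Longrightarrow> g m (g \<gamma> z) = g \<gamma> (g m z)"
    and free: "\<And>m z. m \<in> K - {\<gamma>} \<Longrightarrow> z \<in> space X \<Longrightarrow> g m z \<noteq> g \<gamma> z"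
    and k: "\<And>m. m \<in> K \<Longrightarrow> fibres_le k (space X) (g m)"
  obtains P where "P \<in> sets X" "\<And>x. x \<in> space X \<Longrightarrow> \<exists>m\<in>K. g m x \<in> P"
    "\<And>y y' m m'. y \<in> P \<Longrightarrow> y' \<in> P \<Longrightarrow> m \<in> K - {\<gamma>} \<Longrightarrow> m' \<in> K - {\<gamma>} \<Longrightarrow>
      g m y = g \<gamma> y' \<Longrightarrow> g m' y' = g \<gamma> y \<Longrightarrow> False"
proof -
  \<comment> \<open>The relation \<open>g m z = g \<gamma> z'\<close> is directed; adding the
    swapped pairs makes the family symmetric without changing which colourings are proper.\<close>
  define \<F> where "\<F> = (\<lambda>m. (g m, g \<gamma>)) ` (K - {\<gamma>}) \<union> (\<lambda>m. (g \<gamma>, g m)) ` (K - {\<gamma>})"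
  obtain \<psi> :: "'a \<Rightarrow> nat" where \<psi>: "\<psi> \<in> X \<rightarrow>\<^sub>M count_space UNIV"
    "\<And>m z z'. m \<in> K - {\<gamma>} \<Longrightarrow> z \<in> space X \<Longrightarrow> z' \<in> space X \<Longrightarrow> g m z = g \<gamma> z' \<Longrightarrow> \<psi> z \<noteq> \<psi> z'"
    by (rule countable_Borel_coloring[OF X, of "K - {\<gamma>}" \<gamma> g]) (use K meas free in auto)
  have proper: "proper_on \<psi> \<F> (space X)"
    unfolding proper_on_def
  proof (intro ballI allI impI)
    fix z z' u v
    assume z: "z \<in> space X" "z' \<in> space X" and uv: "(u, v) \<in> \<F>" "u z = v z'"
    from uv(1) consider m where "m \<in> K - {\<gamma>}" "u = g m" "v = g \<gamma>"
      | m where "m \<in> K - {\<gamma>}" "u = g \<gamma>" "v = g m"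
      by (auto simp: \<F>_def)
    then show "\<psi> z \<noteq> \<psi> z'"
    proof cases
      case 1
      then show ?thesis using \<psi>(2)[of m z z'] z uv(2) by simp
    next
      case 2
      then show ?thesis using \<psi>(2)[of m z' z] z uv(2) by simp
    qed
  qed
  obtain \<phi> l where \<phi>: "\<phi> \<in> X \<rightarrow>\<^sub>M count_space UNIV" "\<And>z. \<phi> z < (l::nat)"
    "proper_on \<phi> \<F> (space X)"
  proof (rule finite_Borel_coloring[OF X, of \<F> k \<psi>])
    show "finite \<F>" using K(1) by (simp add: \<F>_def)
    show "\<psi> \<in> X \<rightarrow>\<^sub>M count_space UNIV" by (rule \<psi>(1))
    show "proper_on \<psi> \<F> (space X)" by (rule proper)
  qed (use meas k K(2) in \<open>auto simp: \<F>_def\<close>)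
  have proper\<phi>: "\<phi> z \<noteq> \<phi> z'" if "m \<in> K - {\<gamma>}" "z \<in> space X" "z' \<in> space X" "g m z = g \<gamma> z'" for m z z'
  proof -
    have "(g m, g \<gamma>) \<in> \<F>" using that(1) by (simp add: \<F>_def)
    then show ?thesis using \<phi>(3) that unfolding proper_on_def by blast
  qed
  show ?thesis
    by (rule forward_marker_set_of_coloring[where g = g and K = K and \<gamma> = \<gamma> and \<phi> = \<phi> and l = l
          and X = X]) (fact K meas comm \<phi> proper\<phi> that)+
qed

section \<open>Actions of commutative monoids\<close>

text \<open>Otherwise \<open>b\<close> would grow along the scales 5^i * s0 at least like 5^((N + 1)
  * i), faster than a polynomial of degree N allows.\<close>

lemma polynomial_growth_doubling:
  fixes b :: "nat \<Rightarrow> nat"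
  assumes b: "\<And>n. b n \<le> (n + 1) ^ N" "\<And>n. b n > 0"
  obtains s where "s \<ge> s0" "b (5 * s) \<le> 5 ^ (N + 1) * b s"
proof -
  have "\<exists>s\<ge>s0. b (5 * s) \<le> 5 ^ (N + 1) * b s"
  proof (rule ccontr)
    assume "\<not> ?thesis"
    then have grow: "5 ^ (N + 1) * b s < b (5 * s)" if "s \<ge> s0" for s
      using that by (meson not_le)
    have lower: "(5 ^ (N + 1)) ^ i \<le> b (5 ^ i * s0)" for i
    proof (induction i)
      case (Suc i)
      have "s0 \<le> 5 ^ i * s0" by simp
      then have "5 ^ (N + 1) * b (5 ^ i * s0) < b (5 * (5 ^ i * s0))" by (rule grow)
      moreover have "5 ^ (N + 1) * (5 ^ (N + 1)) ^ i \<le> 5 ^ (N + 1) * b (5 ^ i * s0)"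
        using Suc by (rule mult_left_mono) simp
      ultimately have "5 ^ (N + 1) * (5 ^ (N + 1)) ^ i \<le> b (5 * (5 ^ i * s0))"
        by linarith
      then show ?case by (simp add: mult.assoc)
    qed (use b(2) in \<open>simp add: Suc_leI\<close>)
    \<comment> \<open>With this i the upper and lower estimates at scale 5^i * s0 reduce to 5^i
      \<le> i.\<close>
    define i where "i = (s0 + 1) ^ N"
    have "5 ^ i * (5 ^ i) ^ N = (5 ^ (N + 1) :: nat) ^ i"
      by (simp add: power_mult[symmetric] power_add[symmetric] algebra_simps)
    also have "\<dots> \<le> (5 ^ i * s0 + 1) ^ N"
      using lower[of i] b(1)[of "5 ^ i * s0"] by linarith
    also have "\<dots> \<le> (5 ^ i * (s0 + 1)) ^ N"
      by (rule power_mono) (simp_all add: Suc_leI)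
    also have "\<dots> = i * (5 ^ i) ^ N"
      by (simp only: power_mult_distrib i_def mult.commute)
    finally have "(5::nat) ^ i \<le> i" by simp
    moreover have "i < 5 ^ i" by (rule less_exp[THEN less_le_trans]) (simp add: power_mono)
    ultimately show False by simp
  qed
  then show ?thesis using that by blast
qed

lemma path_dist_le_iff: "path_dist E x y \<le> enat s \<longleftrightarrow> (\<exists>k\<le>s. (E ^^ k) x y)"
proof
  assume *: "path_dist E x y \<le> enat s"
  show "\<exists>k\<le>s. (E ^^ k) x y"
  proof (rule ccontr)
    assume "\<not> ?thesis"
    then have "enat (Suc s) \<le> path_dist E x y"
      unfolding path_dist_def by (intro Inf_greatest) (auto simp: not_le Suc_le_eq)
    then have "enat (Suc s) \<le> enat s" using * by (rule order_trans)
    then show False by simp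
  qed
next
  assume "\<exists>k\<le>s. (E ^^ k) x y"
  then obtain k where "k \<le> s" "(E ^^ k) x y" by blast
  then have "path_dist E x y \<le> enat k"
    unfolding path_dist_def by (intro Inf_lower) blast
  then show "path_dist E x y \<le> enat s" using \<open>k \<le> s\<close> by (meson enat_ord_simps(1) order_trans)
qed

text \<open>Balls grow with the radius; hence witnesses at arbitrarily large scales suffice.\<close>

lemma uncolored_dim_witness_mono:
  assumes w: "uncolored_dim_witness X E d s f" and t: "t \<le> s"
  shows "uncolored_dim_witness X E d t f"
proof -
  have ball: "f ` graph_ball (space X) E x t \<subseteq> f ` graph_ball (space X) E x s" for x
    using t by (auto simp: graph_ball_def path_dist_le_iff intro: order_trans)
  then show ?thesis
    using w unfolding uncolored_dim_witness_def
    by (meson card_mono finite_subset order_trans)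
qed

section \<open>Cubes in the monoid\<close>

locale free_Borel_action = comm_monoid M for M :: "('m, 'b) monoid_scheme" (structure) +
  fixes X :: "'x measure" and act :: "'m \<Rightarrow> 'x \<Rightarrow> 'x" and R :: "'m set"
  assumes standard: "standard_borel X"
    and action: "monoid_action M (space X) act"
    and free: "free_action M (space X) act"
    and bounded: "bounded_to_one_action M (space X) act"
    and borel: "borel_action M X act"
    and finite_R: "finite R" and R: "R \<subseteq> carrier M"
begin

definition monomial :: "('m \<Rightarrow> nat) \<Rightarrow> 'm" where
  "monomial v = finprod M (\<lambda>\<rho>. \<rho> [^] v \<rho>) R"

text \<open>Boxes of exponents take the place of word balls because a box has a top corner,
  \<open>diag n\<close>, which is a common multiple of all its elements.\<close>

definition cube :: "nat \<Rightarrow> 'm set" where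
  "cube n = monomial ` (R \<rightarrow>\<^sub>E {..n})"

definition diag :: "nat \<Rightarrow> 'm" where
  "diag n = monomial (\<lambda>_. n)"

abbreviation adj :: "'x \<Rightarrow> 'x \<Rightarrow> bool" where
  "adj \<equiv> schreier_adj (space X) act R"

lemma pow_closed: "(\<lambda>\<rho>. \<rho> [^] (v \<rho> :: nat)) \<in> R \<rightarrow> carrier M"
  using R by auto

lemma monomial_closed [simp]: "monomial v \<in> carrier M"
  unfolding monomial_def by (rule finprod_closed[OF pow_closed])

lemma monomial_mult: "monomial v \<otimes> monomial w = monomial (\<lambda>\<rho>. v \<rho> + w \<rho>)"
proof -
  have "monomial (\<lambda>\<rho>. v \<rho> + w \<rho>) = finprod M (\<lambda>\<rho>. \<rho> [^] v \<rho> \<otimes> \<rho> [^] w \<rho>) R"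
    unfolding monomial_def using R
    by (intro finprod_cong') (auto simp: nat_pow_mult subset_iff)
  then show ?thesis
    unfolding monomial_def by (simp add: finprod_multf[OF pow_closed pow_closed])
qed

lemma monomial_cong: "(\<And>\<rho>. \<rho> \<in> R \<Longrightarrow> v \<rho> = w \<rho>) \<Longrightarrow> monomial v = monomial w"
  unfolding monomial_def using R by (intro finprod_cong') auto

lemma monomial_in_cube:
  assumes "\<And>\<rho>. \<rho> \<in> R \<Longrightarrow> v \<rho> \<le> n"
  shows "monomial v \<in> cube n"
proof -
  have "monomial v = monomial (restrict v R)" by (rule monomial_cong) simp
  moreover have "restrict v R \<in> R \<rightarrow>\<^sub>E {..n}" using assms by auto
  ultimately show ?thesis unfolding cube_def by blast
qed

lemma cube_monomial:
  assumes "a \<in> cube n"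
  obtains v where "a = monomial v" "\<And>\<rho>. \<rho> \<in> R \<Longrightarrow> v \<rho> \<le> n"
  using assms unfolding cube_def by (auto simp: PiE_iff)

lemma cube_closed [simp]: "a \<in> cube n \<Longrightarrow> a \<in> carrier M"
  by (auto simp: cube_def)

lemma finite_cube [simp]: "finite (cube n)"
  unfolding cube_def by (intro finite_imageI finite_PiE finite_R) simp

lemma card_cube_le: "card (cube n) \<le> (n + 1) ^ card R"
proof -
  have "card (cube n) \<le> card (R \<rightarrow>\<^sub>E {..n})"
    unfolding cube_def by (intro card_image_le finite_PiE finite_R) simp
  then show ?thesis by (simp add: card_PiE[OF finite_R])
qed

lemma diag_in_cube: "diag n \<in> cube n"
  unfolding diag_def by (rule monomial_in_cube) simp

lemma diag_closed [simp]: "diag n \<in> carrier M"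
  by (simp add: diag_def)

lemma diag_add: "diag m \<otimes> diag n = diag (m + n)"
  by (simp add: diag_def monomial_mult)

lemma card_cube_pos: "card (cube n) > 0"
  using diag_in_cube[of n] by (auto simp: card_gt_0_iff)

lemma cube_mono: "m \<le> n \<Longrightarrow> cube m \<subseteq> cube n"
proof
  fix a assume "m \<le> n" "a \<in> cube m"
  then show "a \<in> cube n" by (auto elim!: cube_monomial intro!: monomial_in_cube intro: le_trans)
qed

lemma cube_mult:
  assumes "a \<in> cube m" "b \<in> cube n"
  shows "a \<otimes> b \<in> cube (m + n)"
proof -
  obtain v where v: "a = monomial v" "\<And>\<rho>. \<rho> \<in> R \<Longrightarrow> v \<rho> \<le> m"
    using cube_monomial[OF assms(1)] by blast
  obtain w where w: "b = monomial w" "\<And>\<rho>. \<rho> \<in> R \<Longrightarrow> w \<rho> \<le> n"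
    using cube_monomial[OF assms(2)] by blast
  show ?thesis
    unfolding v(1) w(1) monomial_mult
    by (rule monomial_in_cube) (simp add: v(2) w(2) add_mono)
qed

text \<open>Complementary exponents serve in place of inverses: multiplication by \<open>a\<close>
  can be undone up to translation by \<open>diag n\<close>.\<close>

lemma cube_complement:
  assumes "a \<in> cube n"
  obtains a' where "a' \<in> cube n" "a' \<otimes> a = diag n"
proof -
  obtain v where v: "a = monomial v" "\<And>\<rho>. \<rho> \<in> R \<Longrightarrow> v \<rho> \<le> n"
    using cube_monomial[OF assms] by blast
  show ?thesis
  proof
    show "monomial (\<lambda>\<rho>. n - v \<rho>) \<in> cube n" by (rule monomial_in_cube) simp
    show "monomial (\<lambda>\<rho>. n - v \<rho>) \<otimes> a = diag n"
      unfolding v(1) monomial_mult diag_def by (rule monomial_cong) (simp add: v(2))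
  qed
qed

lemma generator_in_cube:
  assumes "\<rho> \<in> R"
  shows "\<rho> \<in> cube 1"
proof -
  have "monomial (\<lambda>\<sigma>. if \<sigma> = \<rho> then 1 else 0) = finprod M (\<lambda>\<sigma>. if \<rho> = \<sigma> then \<sigma> else \<one>) R"
    unfolding monomial_def using R by (intro finprod_cong') auto
  also have "\<dots> = \<rho>"
    using finprod_singleton[OF assms finite_R, of "\<lambda>\<sigma>. \<sigma>"] R by auto
  finally have "monomial (\<lambda>\<sigma>. if \<sigma> = \<rho> then 1 else 0) = \<rho>" .
  moreover have "monomial (\<lambda>\<sigma>. if \<sigma> = \<rho> then 1 else 0) \<in> cube 1"
    by (rule monomial_in_cube) simp
  ultimately show ?thesis by simp
qed

lemma act_space [simp]: "m \<in> carrier M \<Longrightarrow> x \<in> space X \<Longrightarrow> act m x \<in> space X"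
  using action by (auto simp: monoid_action_def)

lemma act_mult: "m \<in> carrier M \<Longrightarrow> n \<in> carrier M \<Longrightarrow> x \<in> space X \<Longrightarrow> act (m \<otimes> n) x = act m (act n x)"
  using action by (auto simp: monoid_action_def)

lemma act_one: "x \<in> space X \<Longrightarrow> act \<one> x = x"
  using action by (auto simp: monoid_action_def)

lemma act_measurable: "m \<in> carrier M \<Longrightarrow> act m \<in> X \<rightarrow>\<^sub>M X"
  using borel by (auto simp: borel_action_def)

lemma act_commute:
  assumes "m \<in> carrier M" "n \<in> carrier M" "x \<in> space X"
  shows "act m (act n x) = act n (act m x)"
  using assms by (metis act_mult m_comm)

lemma act_eqD:
  "act m x = act n x \<Longrightarrow> m \<in> carrier M \<Longrightarrow> n \<in> carrier M \<Longrightarrow> x \<in> space X \<Longrightarrow> m = n"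
  using free by (auto simp: free_action_def)

text \<open>Cancellation is not assumed of the monoid; it comes from freeness at the point
  \<open>act c x\<close>, where p and q act alike by commutativity.\<close>

lemma mult_cancel:
  assumes "x \<in> space X" "c \<otimes> p = c \<otimes> q" "c \<in> carrier M" "p \<in> carrier M" "q \<in> carrier M"
  shows "p = q"
proof (rule act_eqD)
  show "act p (act c x) = act q (act c x)"
    using assms by (metis act_commute act_mult)
qed (use assms in auto)

text \<open>Translating by a power of the product of the generators moves an undirected ball into the
  forward orbit of its centre.\<close>

lemma walk_to_forward_orbit:
  assumes "(adj ^^ k) x y" "x \<in> space X"
  shows "y \<in> space X \<and> (\<exists>m\<in>cube (2 * k). act (diag k) y = act m x)"
  using assms(1)
proof (induction k arbitrary: y)
  case 0
  then show ?case using assms(2) diag_in_cube[of 0] by auto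
next
  case (Suc k)
  then obtain z where z: "(adj ^^ k) x z" "adj z y" by auto
  then obtain m where m: "m \<in> cube (2 * k)" "act (diag k) z = act m x" using Suc.IH by blast
  obtain \<rho> where \<rho>: "\<rho> \<in> R" "y = act \<rho> z \<or> z = act \<rho> y" and zy: "z \<in> space X" "y \<in> space X"
    using z(2) by (auto simp: schreier_adj_def)
  have \<rho>M [simp]: "\<rho> \<in> carrier M" using \<rho>(1) R by blast
  have mM [simp]: "m \<in> carrier M" using m(1) by simp
  have diag: "diag (Suc k) = diag 1 \<otimes> diag k" by (simp add: diag_add)
  from \<rho>(2) show ?case
  proof
    assume y: "y = act \<rho> z"
    have "act (diag (Suc k)) y = act (diag 1) (act \<rho> (act (diag k) z))"
      unfolding diag y using zy by (simp add: act_mult act_commute[of "diag k" \<rho>])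
    also have "\<dots> = act (diag 1 \<otimes> \<rho> \<otimes> m) x"
      using assms(2) by (simp add: m(2) act_mult)
    finally have "act (diag (Suc k)) y = act (diag 1 \<otimes> \<rho> \<otimes> m) x" .
    \<comment> \<open>A forward edge costs two units, the generator and the new diagonal factor; a
      backward edge costs one, since a complement of the generator takes the place of both. Hence
      the radius \<open>2 * k\<close>.\<close>
    moreover have "diag 1 \<otimes> \<rho> \<otimes> m \<in> cube (1 + 1 + 2 * k)"
      by (intro cube_mult diag_in_cube generator_in_cube \<rho> m)
    ultimately show ?thesis using zy by auto
  next
    assume z: "z = act \<rho> y"
    obtain a where a: "a \<in> cube 1" "a \<otimes> \<rho> = diag 1"
      using cube_complement[OF generator_in_cube[OF \<rho>(1)]] .
    have [simp]: "a \<in> carrier M" using a(1) by simp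
    have "act (diag (Suc k)) y = act a (act (diag k) z)"
      unfolding diag a(2)[symmetric] z using zy by (simp add: act_mult act_commute[of "diag k" \<rho>])
    also have "\<dots> = act (a \<otimes> m) x" using assms(2) by (simp add: m(2) act_mult)
    finally have "act (diag (Suc k)) y = act (a \<otimes> m) x" .
    moreover have "a \<otimes> m \<in> cube (1 + 2 * k)" by (intro cube_mult a m)
    then have "a \<otimes> m \<in> cube (2 * Suc k)" using cube_mono[of "1 + 2 * k" "2 * Suc k"] by auto
    ultimately show ?thesis using zy by auto
  qed
qed

text \<open>Walks inside a ball have different lengths; further diagonal factors let the single
  translation \<open>diag s\<close> work for all its points.\<close>

lemma ball_to_forward_orbit:
  assumes "y \<in> graph_ball (space X) adj x s" "x \<in> space X"
  shows "\<exists>m\<in>cube (2 * s). act (diag s) y = act m x"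
proof -
  have y: "y \<in> space X" using assms(1) by (simp add: graph_ball_def)
  obtain k where k: "k \<le> s" "(adj ^^ k) x y"
    using assms(1) by (auto simp: graph_ball_def path_dist_le_iff)
  then obtain m where m: "m \<in> cube (2 * k)" "act (diag k) y = act m x"
    using walk_to_forward_orbit assms(2) by blast
  have "act (diag s) y = act (diag (s - k)) (act (diag k) y)"
    using k(1) y by (simp add: act_mult[symmetric] diag_add)
  also have "\<dots> = act (diag (s - k) \<otimes> m) x"
    using m assms(2) by (simp add: act_mult)
  finally have "act (diag s) y = act (diag (s - k) \<otimes> m) x" .
  moreover have "diag (s - k) \<otimes> m \<in> cube (s - k + 2 * k)"
    by (intro cube_mult diag_in_cube m)
  then have "diag (s - k) \<otimes> m \<in> cube (2 * s)"
    using cube_mono[of "s - k + 2 * k" "2 * s"] k(1) by auto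
  ultimately show ?thesis by blast
qed

section \<open>Displacement in the Schreier graph\<close>

definition displacement_le :: "nat \<Rightarrow> 'm \<Rightarrow> bool" where
  "displacement_le k m \<longleftrightarrow> (\<forall>x\<in>space X. path_dist adj x (act m x) \<le> enat k)"

lemma displacement_one: "displacement_le 0 \<one>"
  by (simp add: displacement_le_def path_dist_le_iff act_one)

lemma displacement_generator:
  assumes "\<rho> \<in> R"
  shows "displacement_le 1 \<rho>"
  unfolding displacement_le_def path_dist_le_iff
proof
  fix x assume x: "x \<in> space X"
  have "\<rho> \<in> carrier M" using R assms by blast
  then have "x = act \<rho> x \<or> adj x (act \<rho> x)"
    using assms x by (auto simp: schreier_adj_def)
  then show "\<exists>k\<le>1. (adj ^^ k) x (act \<rho> x)"
  proof
    assume "x = act \<rho> x"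
    then show ?thesis by (intro exI[of _ 0]) simp
  next
    assume "adj x (act \<rho> x)"
    then show ?thesis by (intro exI[of _ 1]) auto
  qed
qed

lemma displacement_mult:
  assumes "displacement_le k m" "displacement_le l n" "m \<in> carrier M" "n \<in> carrier M"
  shows "displacement_le (k + l) (m \<otimes> n)"
  unfolding displacement_le_def path_dist_le_iff
proof
  fix x assume x: "x \<in> space X"
  obtain i where i: "i \<le> l" "(adj ^^ i) x (act n x)"
    using assms(2) x by (auto simp: displacement_le_def path_dist_le_iff)
  obtain j where j: "j \<le> k" "(adj ^^ j) (act n x) (act m (act n x))"
    using assms(1) act_space[OF assms(4) x] unfolding displacement_le_def path_dist_le_iff by blast
  have "(adj ^^ (i + j)) x (act (m \<otimes> n) x)"
    using i j assms x by (auto simp: relpowp_add act_mult)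
  then show "\<exists>p\<le>k + l. (adj ^^ p) x (act (m \<otimes> n) x)"
    using i j by (intro exI[of _ "i + j"]) simp
qed

lemma displacement_power:
  assumes "\<rho> \<in> R"
  shows "displacement_le k (\<rho> [^] k)"
proof (induction k)
  case 0
  then show ?case using displacement_one by simp
next
  case (Suc k)
  have "\<rho> \<in> carrier M" using R assms by blast
  then have "displacement_le (k + 1) (\<rho> [^] k \<otimes> \<rho>)"
    by (intro displacement_mult Suc displacement_generator assms) auto
  then show ?case by simp
qed

text \<open>The exponents add up to at most \<open>card R * n\<close>, and each unit of exponent
  moves a point along at most one edge.\<close>

lemma displacement_cube:
  assumes "m \<in> cube n"
  shows "displacement_le (card R * n) m"
proof -
  obtain v where v: "m = monomial v" "\<And>\<rho>. \<rho> \<in> R \<Longrightarrow> v \<rho> \<le> n"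
    using cube_monomial[OF assms] by blast
  have "displacement_le (\<Sum>\<rho>\<in>A. v \<rho>) (finprod M (\<lambda>\<rho>. \<rho> [^] v \<rho>) A)" if "finite A" "A \<subseteq> R" for A
    using that
  proof (induction A rule: finite_induct)
    case empty
    then show ?case using displacement_one by simp
  next
    case (insert \<rho> A)
    have car: "\<rho> \<in> carrier M" "(\<lambda>\<rho>. \<rho> [^] v \<rho>) \<in> A \<rightarrow> carrier M"
      using insert.prems R by auto
    then have "finprod M (\<lambda>\<rho>. \<rho> [^] v \<rho>) (insert \<rho> A) = \<rho> [^] v \<rho> \<otimes> finprod M (\<lambda>\<rho>. \<rho> [^] v \<rho>) A"
      using insert.hyps by (intro finprod_insert) auto
    moreover have "displacement_le (v \<rho> + (\<Sum>\<rho>\<in>A. v \<rho>))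
        (\<rho> [^] v \<rho> \<otimes> finprod M (\<lambda>\<rho>. \<rho> [^] v \<rho>) A)"
      using insert car by (intro displacement_mult displacement_power) auto
    ultimately show ?case using insert.hyps by simp
  qed
  from this[OF finite_R subset_refl] have "displacement_le (\<Sum>\<rho>\<in>R. v \<rho>) m"
    by (simp add: v(1) monomial_def)
  moreover have "(\<Sum>\<rho>\<in>R. v \<rho>) \<le> card R * n"
    using sum_bounded_above[of R v n] v(2) by simp
  ultimately show ?thesis
    unfolding displacement_le_def by (meson enat_ord_simps(1) order_trans)
qed

lemma cube_fibres_le: "\<exists>k. \<forall>m\<in>cube n. fibres_le k (space X) (act m)"
proof -
  have "\<forall>m\<in>cube n. \<exists>k. fibres_le k (space X) (act m)"
    using bounded by (auto simp: bounded_to_one_action_def fibres_le_def)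
  then obtain k where k: "\<And>m. m \<in> cube n \<Longrightarrow> fibres_le (k m) (space X) (act m)" by metis
  have "fibres_le (\<Sum>m\<in>cube n. k m) (space X) (act m)" if m: "m \<in> cube n" for m
  proof -
    have "k m \<le> (\<Sum>m\<in>cube n. k m)" using m by (intro member_le_sum) auto
    then show ?thesis using k[OF m] unfolding fibres_le_def by (meson le_trans)
  qed
  then show ?thesis by blast
qed

section \<open>Markers with disjoint cubes and the dimension bound\<close>

text \<open>If the s-cubes at the markers p x and q x meet, complements b' and a' turn
  \<open>a \<otimes> p = b \<otimes> q\<close> into the two equations of a conflict, with
  multipliers b' a and a' b from \<open>cube (2 * s)\<close> and with \<open>diag s\<close> as the
  fixed element.\<close>

lemma forward_markers:
  obtains P where "P \<in> sets X" "\<And>x. x \<in> space X \<Longrightarrow> \<exists>m\<in>cube (2 * s). act m x \<in> P"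
    "\<And>x p q a b. x \<in> space X \<Longrightarrow> p \<in> carrier M \<Longrightarrow> q \<in> carrier M \<Longrightarrow> act p x \<in> P \<Longrightarrow> act q x \<in> P \<Longrightarrow>
       a \<in> cube s \<Longrightarrow> b \<in> cube s \<Longrightarrow> a \<otimes> p = b \<otimes> q \<Longrightarrow> p = q"
proof -
  obtain k where k: "\<And>m. m \<in> cube (2 * s) \<Longrightarrow> fibres_le k (space X) (act m)"
    using cube_fibres_le by blast
  have diag: "diag s \<in> cube (2 * s)" using diag_in_cube[of s] cube_mono[of s "2 * s"] by auto
  obtain P where P: "P \<in> sets X" "\<And>x. x \<in> space X \<Longrightarrow> \<exists>m\<in>cube (2 * s). act m x \<in> P"
    and sep: "\<And>y y' m m'. y \<in> P \<Longrightarrow> y' \<in> P \<Longrightarrow> m \<in> cube (2 * s) - {diag s} \<Longrightarrow>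
      m' \<in> cube (2 * s) - {diag s} \<Longrightarrow> act m y = act (diag s) y' \<Longrightarrow> act m' y' = act (diag s) y \<Longrightarrow> False"
  proof (rule forward_marker_set[OF standard, of "cube (2 * s)" "diag s" act k])
    fix m z assume m: "m \<in> cube (2 * s) - {diag s}" "z \<in> space X"
    then show "act m z \<noteq> act (diag s) z" using act_eqD[of m z "diag s"] by auto
  qed (use diag k in \<open>auto intro: act_measurable act_commute\<close>)
  have half: "p = q \<or> m \<in> cube (2 * s) - {diag s} \<and> act m (act p x) = act (diag s) (act q x)"
    if x: "x \<in> space X" and pq: "p \<in> carrier M" "q \<in> carrier M"
      and ab: "a \<in> cube s" "b' \<in> cube s" "b' \<otimes> b = diag s" "a \<otimes> p = b \<otimes> q" "b \<in> cube s"
      and m: "m = b' \<otimes> a" for x p q a b b' m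
  proof (cases "p = q")
    case False
    have "m \<in> cube (s + s)" unfolding m by (intro cube_mult ab)
    then have "m \<in> cube (2 * s)" by (simp add: mult_2)
    moreover have mp: "m \<otimes> p = diag s \<otimes> q"
      using ab pq unfolding m ab(3)[symmetric] by (simp add: m_assoc)
    \<comment> \<open>A multiplier equal to \<open>diag s\<close> would give p = q by
      cancellation.\<close>
    then have "m \<noteq> diag s" using mult_cancel[OF x _ diag_closed pq] False by blast
    moreover have "act m (act p x) = act (diag s) (act q x)"
      using mp x pq \<open>m \<in> cube (2 * s)\<close> by (metis act_mult cube_closed diag_closed)
    ultimately show ?thesis by blast
  qed simp
  show ?thesis
  proof (rule that[OF P])
    fix x p q a b
    assume *: "x \<in> space X" "p \<in> carrier M" "q \<in> carrier M" "act p x \<in> P" "act q x \<in> P"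
      "a \<in> cube s" "b \<in> cube s" "a \<otimes> p = b \<otimes> q"
    obtain a' where a': "a' \<in> cube s" "a' \<otimes> a = diag s" using cube_complement[OF *(6)] .
    obtain b' where b': "b' \<in> cube s" "b' \<otimes> b = diag s" using cube_complement[OF *(7)] .
    show "p = q"
      using half[OF *(1,2,3,6) b' *(8,7) refl] half[OF *(1,3,2,7) a' *(8)[symmetric] *(6) refl]
        sep[OF *(4,5)] by blast
  qed
qed

text \<open>Push y forward by \<open>diag s\<close>, then move to a marker. The ball about x only
  reaches markers p x with p in \<open>cube (4 * s)\<close>, and the translates of
  \<open>cube s\<close> by these p are disjoint inside \<open>cube (5 * s)\<close>; comparing
  cardinalities bounds their number by d.\<close>

lemma uncolored_dim_witness_at_doubling_scale:
  assumes d: "card (cube (5 * s)) \<le> d * card (cube s)"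
  shows "\<exists>f. uncolored_dim_witness X adj d s f"
proof -
  obtain P where P: "P \<in> sets X" "\<And>x. x \<in> space X \<Longrightarrow> \<exists>m\<in>cube (2 * s). act m x \<in> P"
    and sep: "\<And>x p q a b. x \<in> space X \<Longrightarrow> p \<in> carrier M \<Longrightarrow> q \<in> carrier M \<Longrightarrow> act p x \<in> P \<Longrightarrow>
      act q x \<in> P \<Longrightarrow> a \<in> cube s \<Longrightarrow> b \<in> cube s \<Longrightarrow> a \<otimes> p = b \<otimes> q \<Longrightarrow> p = q"
    using forward_markers[of s] by metis
  define e where "e = from_nat_into (cube (2 * s))"
  have e: "range e = cube (2 * s)"
    unfolding e_def using card_cube_pos[of "2 * s"] by (intro range_from_nat_into countable_finite) auto
  then have eM: "e i \<in> carrier M" for i by (metis cube_closed rangeI)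
  \<comment> \<open>Taking the least index of a countable enumeration makes the choice of the marker
    Borel.\<close>
  define idx where "idx = (\<lambda>x. LEAST i. act (e i) x \<in> P)"
  define F where "F = (\<lambda>x. act (e (idx x)) x)"
  have idx: "act (e (idx x)) x \<in> P" if x: "x \<in> space X" for x
  proof -
    obtain i where "act (e i) x \<in> P" using P(2)[OF x] e by (metis rangeE)
    then show ?thesis unfolding idx_def by (rule LeastI)
  qed
  have "Measurable.pred X (\<lambda>x. act (e i) x \<in> P)" for i
    by (rule pred_sets2[OF P(1) act_measurable[OF eM]])
  then have "idx \<in> X \<rightarrow>\<^sub>M count_space UNIV"
    unfolding idx_def by (rule measurable_Least)
  then have F: "F \<in> X \<rightarrow>\<^sub>M X"
    unfolding F_def by (rule measurable_compose_countable[of "\<lambda>i. act (e i)", OF act_measurable[OF eM]])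
  define f where "f = (\<lambda>y. F (act (diag s) y))"
  have "uncolored_dim_witness X adj d s f"
    unfolding uncolored_dim_witness_def
  proof (intro conjI ballI)
    show "f \<in> X \<rightarrow>\<^sub>M X"
      unfolding f_def by (rule measurable_compose[OF act_measurable[OF diag_closed] F])
    have "path_dist adj x (f x) \<le> enat (card R * (2 * s + s))" if x: "x \<in> space X" for x
    proof -
      define k where "k = e (idx (act (diag s) x))"
      have k: "k \<in> cube (2 * s)" using e by (auto simp: k_def)
      then have "f x = act (k \<otimes> diag s) x"
        using x by (simp add: f_def F_def k_def[symmetric] act_mult)
      then show ?thesis
        using displacement_cube[OF cube_mult[OF k diag_in_cube[of s]]] x
        unfolding displacement_le_def by simp
    qed
    then have "(SUP x\<in>space X. path_dist adj x (f x)) \<le> enat (card R * (2 * s + s))"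
      by (rule SUP_least)
    then show "(SUP x\<in>space X. path_dist adj x (f x)) < \<infinity>"
      by (rule le_less_trans) simp
    fix x assume x: "x \<in> space X"
    \<comment> \<open>2s come from pushing the ball into the orbit of x, 2s from the move to a
      marker.\<close>
    define S where "S = {p \<in> cube (4 * s). act p x \<in> P}"
    have S: "finite S" "\<And>p. p \<in> S \<Longrightarrow> p \<in> carrier M" by (auto simp: S_def)
    have sub: "f ` graph_ball (space X) adj x s \<subseteq> (\<lambda>p. act p x) ` S"
    proof (rule image_subsetI)
      fix y assume y: "y \<in> graph_ball (space X) adj x s"
      obtain m where m: "m \<in> cube (2 * s)" "act (diag s) y = act m x"
        using ball_to_forward_orbit[OF y x] by blast
      define k where "k = e (idx (act m x))"
      have k: "k \<in> cube (2 * s)" using e by (auto simp: k_def)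
      have "act k (act m x) \<in> P" unfolding k_def using idx m(1) x by simp
      moreover have eq: "act (k \<otimes> m) x = act k (act m x)" using k m(1) x by (simp add: act_mult)
      moreover have "k \<otimes> m \<in> cube (4 * s)" using cube_mult[OF k m(1)] by simp
      ultimately have "k \<otimes> m \<in> S" by (simp add: S_def)
      moreover have "f y = act (k \<otimes> m) x" by (simp only: f_def F_def m(2) eq k_def[symmetric])
      ultimately show "f y \<in> (\<lambda>p. act p x) ` S" by blast
    qed
    show "finite (f ` graph_ball (space X) adj x s)"
      by (rule finite_subset[OF sub]) (simp add: S)
    have inj: "inj_on (\<lambda>(a, p). a \<otimes> p) (cube s \<times> S)"
    proof (rule inj_onI, clarify)
      fix a p b q assume *: "a \<in> cube s" "p \<in> S" "b \<in> cube s" "q \<in> S" "a \<otimes> p = b \<otimes> q"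
      have "p = q" using sep[OF x _ _ _ _ *(1,3,5)] * by (auto simp: S_def)
      moreover from this have "p \<otimes> a = p \<otimes> b" using * S(2) by (simp add: m_comm)
      then have "a = b" using mult_cancel[OF x, of p a b] * S(2) by simp
      ultimately show "a = b \<and> p = q" by simp
    qed
    have "(\<lambda>(a, p). a \<otimes> p) ` (cube s \<times> S) \<subseteq> cube (5 * s)"
      using cube_mult[of _ s _ "4 * s"] by (auto simp: S_def)
    then have "card (cube s \<times> S) \<le> card (cube (5 * s))"
      using card_inj_on_le[OF inj] by simp
    also have "\<dots> \<le> card (cube s) * d" using d by (simp only: mult.commute)
    finally have "card S \<le> d"
      using card_cube_pos[of s] by (simp add: card_cartesian_product)
    moreover have "card (f ` graph_ball (space X) adj x s) \<le> card S"
      using surj_card_le[OF S(1) sub] .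
    ultimately show "card (f ` graph_ball (space X) adj x s) \<le> d + 1" by simp
  qed
  then show ?thesis by blast
qed

text \<open>\<open>card R\<close> is the degree of the polynomial bound on
  \<open>card (cube n)\<close>. The given scale is replaced by a larger one with bounded growth
  ratio, the bound being the same for all scales.\<close>

theorem borel_asdim_le: "borel_asdim_le X adj (5 ^ (card R + 1))"
  unfolding borel_asdim_le_def
proof
  fix t
  obtain s where s: "s \<ge> t" "card (cube (5 * s)) \<le> 5 ^ (card R + 1) * card (cube s)"
    using polynomial_growth_doubling[of "\<lambda>n. card (cube n)" "card R" t] card_cube_le card_cube_pos
    by blast
  then show "\<exists>f. uncolored_dim_witness X adj (5 ^ (card R + 1)) t f"
    using uncolored_dim_witness_at_doubling_scale[OF s(2)] uncolored_dim_witness_mono[OF _ s(1)]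
    by blast
qed

corollary borel_asdim_finite: "borel_asdim X adj < \<infinity>"
proof -
  have "borel_asdim X adj \<le> enat (5 ^ (card R + 1))"
    unfolding borel_asdim_def by (rule Inf_lower) (use borel_asdim_le in blast)
  then show ?thesis by (rule le_less_trans) simp
qed

end

theorem theorem1p6:
  fixes M :: "('m, 'b) monoid_scheme"
    and X :: "'x measure"
    and act :: "'m \<Rightarrow> 'x \<Rightarrow> 'x"
  assumes "comm_monoid M"
    and "finitely_generated M"
    and "standard_borel X"
    and "monoid_action M (space X) act"
    and "free_action M (space X) act"
    and "bounded_to_one_action M (space X) act"
    and "borel_action M X act"
  shows "borel_asdim_action M X act < \<infinity> \<and>
         (\<forall>R. finite R \<and> generates M R \<longrightarrow>
              borel_asdim X (schreier_adj (space X) act R) < \<infinity>)"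
proof -
  have fin: "borel_asdim X (schreier_adj (space X) act R) < \<infinity>"
    if "finite R" "generates M R" for R
  proof -
    have "free_Borel_action M X act R"
      using assms that
      by (simp add: free_Borel_action_def free_Borel_action_axioms_def generates_def)
    then show ?thesis by (rule free_Borel_action.borel_asdim_finite)
  qed
  moreover have "\<exists>R. finite R \<and> generates M R"
    using assms(2) by (simp add: finitely_generated_def)
  then have "finite (SOME R. finite R \<and> generates M R) \<and> generates M (SOME R. finite R \<and> generates M R)"
    by (rule someI_ex)
  ultimately show ?thesis unfolding borel_asdim_action_def by blast
qed

end
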